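(* Let $O^{(1)},\dots,O^{(k)}$ be arbitrary operators on $h$ and let $t_1,\dots,t_k\in\{0,\dots,N-1\}$, where repetitions are allowed. Then $$\mathrm{Tr}\Big[Pe^{i\epsilon\mathcal P}\,O^{(1)}_{t_1}\cdots O^{(k)}_{t_k}\Big]=\mathrm{tr}\Big[\hat T\big[O^{(1)}(t_1)\cdots O^{(k)}(t_k)\big]\Big],$$ where $O^{(l)}(t_l)$ denotes the operator $O^{(l)}$ itself, carrying the time label $t_l$.
   Context: Fix integers $L\ge1$, $N\ge1$, a real $\epsilon>0$, and set $T=\epsilon N$. The space $h$. Let $h$ be the fermionic Fock space of $L$ modes, with vacuum $|0\rangle$, ladder operators $a_i$ satisfying $\{a_i,a_j^\dagger\}=\delta_{ij}$ and $\{a_i,a_j\}=\{a_i^\dagger,a_j^\dagger\}=0$, and trace $\mathrm{tr}$. The space $\mathcal H$. Let $\mathcal H$ be the Fock space generated from a vacuum $|\Omega\rangle$ by $a_{ti}$, $t=0,\dots,N-1$, $i=1,\dots,L$, with $\{a_{ti},a^\dagger_{t'j}\}=\delta_{tt'}\delta_{ij}$ and all other anticommutators zero. The symbol $\mathrm{Tr}$ is the trace on $\mathcal H$. Time translations and parity. Set $\omega_n=(2n+1)\pi/T$ and $\hat a_{ni}=N^{-1/2}\sum_te^{i\omega_n\epsilon t}a_{ti}$. Define $$\mathcal P=\sum_{n,j}\omega_n\hat a^\dagger_{nj}\hat a_{nj},\qquad P=\exp\Big(i\pi\sum_{t,i}a^\dagger_{ti}a_{ti}\Big).$$ Placing operators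 on a slice. For an operator $O$ on $h$, $O_t$ denotes its image under the unital $*$-homomorphism determined by $a_i\mapsto a_{ti}$. Equivalently, substitute $a_i\to a_{ti}$ and $a_j^\dagger\to a^\dagger_{tj}$ in a polynomial expression of $O$. Parity. An operator on $h$ is even (resp. odd) if it commutes (resp. anticommutes) with $e^{i\pi\sum_ia_i^\dagger a_i}$. Fermionic time ordering $\hat T$. Let $B_1,\dots,B_k$ be operators of definite parity with real labels $s_1,\dots,s_k$. Let $\sigma$ be the unique permutation with $s_{\sigma(1)}\ge\dots\ge s_{\sigma(k)}$ that preserves the relative order of equal labels. Define $$\hat T[B_1\cdots B_k]=(-1)^\gamma B_{\sigma(1)}\cdots B_{\sigma(k)},$$ where $\gamma$ is the number of pairs of odd operators whose order is reversed by $\sigma$. $\hat T$ is extended multilinearly by splitting operators into even and odd parts. *)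

theory Defs
  imports Complex_Main "HOL-Library.Product_Lexorder" "HOL-Combinatorics.Permutations"
begin

text \<open>A fermionic Fock space over a finite, linearly ordered set of modes M has the
orthonormal occupation-number basis |S>, S a subset of M.  An operator is represented by
its matrix elements X S T = <S|X|T>; it is an operator on the Fock space over M iff
its matrix elements vanish outside Pow M x Pow M.  Ladder operators are the standard
Jordan-Wigner ones: a_i |T> = (-1)^(number of j in T with j < i) |T - {i}> if i in T,
and 0 otherwise.\<close>

type_synonym 'm op = "'m set \<Rightarrow> 'm set \<Rightarrow> complex"

definition is_op :: "'m set \<Rightarrow> 'm op \<Rightarrow> bool" where
  "is_op M X \<longleftrightarrow> (\<forall>S T. X S T \<noteq> 0 \<longrightarrow> S \<subseteq> M \<and> T \<subseteq> M)"

definition op_zero :: "'m op" where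
  "op_zero = (\<lambda>S T. 0)"

definition op_one :: "'m set \<Rightarrow> 'm op" where
  "op_one M = (\<lambda>S T. if S = T \<and> S \<subseteq> M then 1 else 0)"

definition op_add :: "'m op \<Rightarrow> 'm op \<Rightarrow> 'm op" where
  "op_add X Y = (\<lambda>S T. X S T + Y S T)"

definition op_diff :: "'m op \<Rightarrow> 'm op \<Rightarrow> 'm op" where
  "op_diff X Y = (\<lambda>S T. X S T - Y S T)"

definition op_scale :: "complex \<Rightarrow> 'm op \<Rightarrow> 'm op" where
  "op_scale c X = (\<lambda>S T. c * X S T)"

definition op_sum :: "('i \<Rightarrow> 'm op) \<Rightarrow> 'i set \<Rightarrow> 'm op" where
  "op_sum f A = (\<lambda>S T. \<Sum>a\<in>A. f a S T)"

definition op_mult :: "'m set \<Rightarrow> 'm op \<Rightarrow> 'm op \<Rightarrow> 'm op" where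
  "op_mult M X Y = (\<lambda>S U. \<Sum>T\<in>Pow M. X S T * Y T U)"

definition op_adj :: "'m op \<Rightarrow> 'm op" where
  "op_adj X = (\<lambda>S T. cnj (X T S))"

definition op_trace :: "'m set \<Rightarrow> 'm op \<Rightarrow> complex" where
  "op_trace M X = (\<Sum>S\<in>Pow M. X S S)"

fun op_pow :: "'m set \<Rightarrow> 'm op \<Rightarrow> nat \<Rightarrow> 'm op" where
  "op_pow M X 0 = op_one M"
| "op_pow M X (Suc n) = op_mult M X (op_pow M X n)"

definition op_exp :: "'m set \<Rightarrow> 'm op \<Rightarrow> 'm op" where
  "op_exp M X = (\<lambda>S T. \<Sum>n. op_pow M X n S T / of_nat (fact n))"

fun op_list_prod :: "'m set \<Rightarrow> 'm op list \<Rightarrow> 'm op" where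
  "op_list_prod M [] = op_one M"
| "op_list_prod M (X # Xs) = op_mult M X (op_list_prod M Xs)"

definition ann :: "'m::linorder set \<Rightarrow> 'm \<Rightarrow> 'm op" where
  "ann M i = (\<lambda>S T. if i \<in> M \<and> T \<subseteq> M \<and> i \<in> T \<and> S = T - {i}
                     then (-1) ^ card {j\<in>T. j < i} else 0)"

definition cre :: "'m::linorder set \<Rightarrow> 'm \<Rightarrow> 'm op" where
  "cre M i = op_adj (ann M i)"

definition number_op :: "'m::linorder set \<Rightarrow> 'm op" where
  "number_op M = op_sum (\<lambda>i. op_mult M (cre M i) (ann M i)) M"

definition parity_op :: "'m::linorder set \<Rightarrow> 'm op" where
  "parity_op M = op_exp M (op_scale (\<i> * of_real pi) (number_op M))"

text \<open>Modes of h: i = 1..L.  Modes of \<H>: (t,i) with t = 0..N-1, i = 1..L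
(ordered lexicographically for the Jordan-Wigner signs).\<close>

definition modes_h :: "nat \<Rightarrow> nat set" where
  "modes_h L = {1..L}"

definition modes_H :: "nat \<Rightarrow> nat \<Rightarrow> (nat \<times> nat) set" where
  "modes_H N L = {0..<N} \<times> {1..L}"

definition omega :: "real \<Rightarrow> nat \<Rightarrow> nat \<Rightarrow> real" where
  "omega \<epsilon> N n = (2 * real n + 1) * pi / (\<epsilon> * real N)"

definition ahat :: "real \<Rightarrow> nat \<Rightarrow> nat \<Rightarrow> nat \<Rightarrow> nat \<Rightarrow> (nat \<times> nat) op" where
  "ahat \<epsilon> N L n i = op_scale (of_real (1 / sqrt (real N)))
     (op_sum (\<lambda>t. op_scale (exp (\<i> * of_real (omega \<epsilon> N n * \<epsilon> * real t))) (ann (modes_H N L) (t, i)))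
             {0..<N})"

definition calP :: "real \<Rightarrow> nat \<Rightarrow> nat \<Rightarrow> (nat \<times> nat) op" where
  "calP \<epsilon> N L = op_sum (\<lambda>(n, j). op_scale (of_real (omega \<epsilon> N n))
       (op_mult (modes_H N L) (op_adj (ahat \<epsilon> N L n j)) (ahat \<epsilon> N L n j))) ({0..<N} \<times> {1..L})"

definition unital_star_hom :: "'a set \<Rightarrow> 'b set \<Rightarrow> ('a op \<Rightarrow> 'b op) \<Rightarrow> bool" where
  "unital_star_hom A B \<phi> \<longleftrightarrow>
     (\<forall>X. is_op A X \<longrightarrow> is_op B (\<phi> X)) \<and>
     (\<forall>X. \<not> is_op A X \<longrightarrow> \<phi> X = op_zero) \<and>
     (\<forall>X Y. is_op A X \<longrightarrow> is_op A Y \<longrightarrow> \<phi> (op_add X Y) = op_add (\<phi> X) (\<phi> Y)) \<and>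
     (\<forall>c X. is_op A X \<longrightarrow> \<phi> (op_scale c X) = op_scale c (\<phi> X)) \<and>
     (\<forall>X Y. is_op A X \<longrightarrow> is_op A Y \<longrightarrow> \<phi> (op_mult A X Y) = op_mult B (\<phi> X) (\<phi> Y)) \<and>
     \<phi> (op_one A) = op_one B \<and>
     (\<forall>X. is_op A X \<longrightarrow> \<phi> (op_adj X) = op_adj (\<phi> X))"

text \<open>O_t: image of O under the unital *-homomorphism determined by a_i \<mapsto> a_{ti}
(normalised to send non-operators to 0, which fixes it uniquely as a HOL function).\<close>
definition slice :: "nat \<Rightarrow> nat \<Rightarrow> nat \<Rightarrow> nat op \<Rightarrow> (nat \<times> nat) op" where
  "slice N L t X = (THE \<phi>. unital_star_hom (modes_h L) (modes_H N L) \<phi> \<and>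
       (\<forall>i\<in>{1..L}. \<phi> (ann (modes_h L) i) = ann (modes_H N L) (t, i))) X"

definition is_even_op :: "nat \<Rightarrow> nat op \<Rightarrow> bool" where
  "is_even_op L X \<longleftrightarrow> op_mult (modes_h L) X (parity_op (modes_h L))
                       = op_mult (modes_h L) (parity_op (modes_h L)) X"

definition is_odd_op :: "nat \<Rightarrow> nat op \<Rightarrow> bool" where
  "is_odd_op L X \<longleftrightarrow> op_mult (modes_h L) X (parity_op (modes_h L))
                       = op_scale (-1) (op_mult (modes_h L) (parity_op (modes_h L)) X)"

definition even_part :: "nat \<Rightarrow> nat op \<Rightarrow> nat op" where
  "even_part L X = (THE E. is_op (modes_h L) E \<and> is_even_op L E \<and> is_odd_op L (op_diff X E))"

definition odd_part :: "nat \<Rightarrow> nat op \<Rightarrow> nat op" where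
  "odd_part L X = op_diff X (even_part L X)"

definition sort_perm :: "nat \<Rightarrow> (nat \<Rightarrow> real) \<Rightarrow> nat \<Rightarrow> nat" where
  "sort_perm k s = (THE \<sigma>. \<sigma> permutes {0..<k} \<and>
       (\<forall>p q. p < q \<and> q < k \<longrightarrow> s (\<sigma> q) \<le> s (\<sigma> p)) \<and>
       (\<forall>p q. p < q \<and> q < k \<and> s (\<sigma> p) = s (\<sigma> q) \<longrightarrow> \<sigma> p < \<sigma> q))"

text \<open>Fermionic time ordering of B_0 ... B_{k-1} with labels s_0 ... s_{k-1}, extended
multilinearly: sum over the set A of indices for which the odd part is taken; gamma counts
pairs of odd factors whose order is reversed by sigma.\<close>
definition time_order :: "nat \<Rightarrow> nat \<Rightarrow> (nat \<Rightarrow> nat op) \<Rightarrow> (nat \<Rightarrow> real) \<Rightarrow> nat op" where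
  "time_order L k B s =
     (let \<sigma> = sort_perm k s in
      op_sum (\<lambda>A. op_scale ((-1) ^ card {(p, q). p < q \<and> q < k \<and> \<sigma> p \<in> A \<and> \<sigma> q \<in> A \<and> \<sigma> q < \<sigma> p})
                 (op_list_prod (modes_h L)
                    (map (\<lambda>p. if \<sigma> p \<in> A then odd_part L (B (\<sigma> p)) else even_part L (B (\<sigma> p)))
                         [0..<k])))
             (Pow {0..<k}))"

end

theory Submission
  imports Defs
begin

text \<open>
  Let \<open>W\<close> be the signed shift of the occupation basis that fixes the vacuum and carries
  \<open>a\<^sup>\<dagger>\<^sub>t\<^sub>i\<close> to \<open>a\<^sup>\<dagger>\<^sub>t\<^sub>+\<^sub>1\<^sub>,\<^sub>i\<close>, with \<open>a\<^sup>\<dagger>\<^sub>N\<^sub>i = - a\<^sup>\<dagger>\<^sub>0\<^sub>i\<close>. Writing \<open>c\<^sub>n\<^sub>j\<close> for the Fourier mode \<open>ahat\<close>,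
  we have \<open>[\<P>, c\<^sub>n\<^sub>j\<^sup>\<dagger>] = \<omega>\<^sub>n c\<^sub>n\<^sub>j\<^sup>\<dagger>\<close> and \<open>W c\<^sub>n\<^sub>j\<^sup>\<dagger> = exp (i \<epsilon> \<omega>\<^sub>n) c\<^sub>n\<^sub>j\<^sup>\<dagger> W\<close>, because the \<open>\<omega>\<^sub>n\<close> are the
  antiperiodic frequencies. Hence the states \<open>c\<^sup>\<dagger> \<cdots> c\<^sup>\<dagger>|\<Omega>\<rangle>\<close>, which span the Fock space, are common
  eigenvectors of \<open>\<P>\<close> and \<open>W\<close>, and \<open>exp (i \<epsilon> \<P>) = W\<close>.

  An operator placed on a slice acts on that slice only, up to the Jordan-Wigner sign of the slices
  below it. Splitting each factor into its even and odd parts and reordering (factors on different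
  slices commute or anticommute) reduces the claim to products \<open>X\<^sub>N\<^sub>-\<^sub>1 \<cdots> X\<^sub>0\<close> with one factor per
  slice. There the trace on the large space is a sum over closed paths of
  \<open>\<Prod>\<^sub>t \<langle>S\<^sub>t|X\<^sub>t|S\<^sub>t\<^sub>-\<^sub>1\<rangle>\<close>, all Jordan-Wigner signs cancelling against the parity and the sign of \<open>W\<close>,
  and this sum is the trace of \<open>X\<^sub>N\<^sub>-\<^sub>1 \<cdots> X\<^sub>0\<close> on the small space.
\<close>

section \<open>Operators as matrices\<close>

notation op_add (infixl "\<oplus>" 65)
notation op_scale (infixr "\<cdot>" 75)

abbreviation op_mult_infix :: "'m op \<Rightarrow> 'm set \<Rightarrow> 'm op \<Rightarrow> 'm op"
  ("(_ \<odot>\<^bsub>_\<^esub>/ _)" [71, 0, 70] 70) where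
  "X \<odot>\<^bsub>M\<^esub> Y \<equiv> op_mult M X Y"

lemma op_mult_assoc: "(X \<odot>\<^bsub>M\<^esub> Y) \<odot>\<^bsub>M\<^esub> Z = X \<odot>\<^bsub>M\<^esub> Y \<odot>\<^bsub>M\<^esub> Z"
proof (intro ext)
  fix S U
  have "((X \<odot>\<^bsub>M\<^esub> Y) \<odot>\<^bsub>M\<^esub> Z) S U = (\<Sum>T\<in>Pow M. \<Sum>R\<in>Pow M. X S R * Y R T * Z T U)"
    by (simp add: op_mult_def sum_distrib_right)
  also have "\<dots> = (\<Sum>R\<in>Pow M. \<Sum>T\<in>Pow M. X S R * Y R T * Z T U)"
    by (rule sum.swap)
  also have "\<dots> = (X \<odot>\<^bsub>M\<^esub> Y \<odot>\<^bsub>M\<^esub> Z) S U"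
    by (simp add: op_mult_def sum_distrib_left mult.assoc)
  finally show "((X \<odot>\<^bsub>M\<^esub> Y) \<odot>\<^bsub>M\<^esub> Z) S U = (X \<odot>\<^bsub>M\<^esub> Y \<odot>\<^bsub>M\<^esub> Z) S U" .
qed

lemma op_mult_add_left: "(X \<oplus> Y) \<odot>\<^bsub>M\<^esub> Z = (X \<odot>\<^bsub>M\<^esub> Z) \<oplus> (Y \<odot>\<^bsub>M\<^esub> Z)"
  by (simp add: fun_eq_iff op_mult_def op_add_def distrib_right sum.distrib)

lemma op_mult_add_right: "X \<odot>\<^bsub>M\<^esub> (Y \<oplus> Z) = (X \<odot>\<^bsub>M\<^esub> Y) \<oplus> (X \<odot>\<^bsub>M\<^esub> Z)"
  by (simp add: fun_eq_iff op_mult_def op_add_def distrib_left sum.distrib)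

lemma op_mult_scale_left: "(c \<cdot> X) \<odot>\<^bsub>M\<^esub> Y = c \<cdot> (X \<odot>\<^bsub>M\<^esub> Y)"
  by (simp add: fun_eq_iff op_mult_def op_scale_def sum_distrib_left mult.assoc)

lemma op_mult_scale_right: "X \<odot>\<^bsub>M\<^esub> (c \<cdot> Y) = c \<cdot> (X \<odot>\<^bsub>M\<^esub> Y)"
  by (simp add: fun_eq_iff op_mult_def op_scale_def sum_distrib_left mult.left_commute)

lemma op_mult_sum_left: "op_sum f I \<odot>\<^bsub>M\<^esub> Y = op_sum (\<lambda>i. f i \<odot>\<^bsub>M\<^esub> Y) I"
  unfolding op_mult_def op_sum_def sum_distrib_right by (intro ext) (rule sum.swap)

lemma op_mult_sum_right: "X \<odot>\<^bsub>M\<^esub> op_sum f I = op_sum (\<lambda>i. X \<odot>\<^bsub>M\<^esub> f i) I"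
  unfolding op_mult_def op_sum_def sum_distrib_left by (intro ext) (rule sum.swap)

lemmas op_mult_linear = op_mult_add_left op_mult_add_right op_mult_scale_left
  op_mult_scale_right op_mult_sum_left op_mult_sum_right

lemma op_scale_scale: "c \<cdot> d \<cdot> X = (c * d) \<cdot> X"
  by (simp add: op_scale_def mult.assoc)

lemma op_scale_one [simp]: "1 \<cdot> X = X"
  by (simp add: op_scale_def)

lemma op_scale_add_right: "c \<cdot> (X \<oplus> Y) = c \<cdot> X \<oplus> c \<cdot> Y"
  by (simp add: op_scale_def op_add_def distrib_left)

lemma op_scale_sum_right: "c \<cdot> op_sum f I = op_sum (\<lambda>i. c \<cdot> f i) I"
  by (simp add: op_scale_def op_sum_def sum_distrib_left)

lemma op_sum_add: "op_sum (\<lambda>i. f i \<oplus> g i) I = op_sum f I \<oplus> op_sum g I"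
  by (simp add: op_sum_def op_add_def sum.distrib)

lemma op_sum_cong: "(\<And>i. i \<in> I \<Longrightarrow> f i = g i) \<Longrightarrow> op_sum f I = op_sum g I"
  by (simp add: op_sum_def)

lemma op_sum_closed:
  assumes "finite I" "P op_zero" "\<And>X Y. P X \<Longrightarrow> P Y \<Longrightarrow> P (X \<oplus> Y)" "\<And>i. i \<in> I \<Longrightarrow> P (f i)"
  shows "P (op_sum f I)"
  using assms(1,4)
proof (induction I rule: finite_induct)
  case empty
  show ?case using assms(2) by (simp add: op_sum_def op_zero_def)
next
  case (insert i I)
  then have "op_sum f (insert i I) = f i \<oplus> op_sum f I"
    by (simp add: op_sum_def op_add_def)
  with insert show ?case by (simp add: assms(3))
qed

lemma is_op_eq_zero: "is_op M X \<Longrightarrow> \<not> (S \<subseteq> M \<and> T \<subseteq> M) \<Longrightarrow> X S T = 0"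
  by (auto simp: is_op_def)

lemma op_eqI:
  assumes "is_op M X" "is_op M Y" "\<And>S T. S \<subseteq> M \<Longrightarrow> T \<subseteq> M \<Longrightarrow> X S T = Y S T"
  shows "X = Y"
proof (intro ext)
  fix S T
  show "X S T = Y S T"
    using assms(3) is_op_eq_zero[OF assms(1)] is_op_eq_zero[OF assms(2)] by (cases "S \<subseteq> M \<and> T \<subseteq> M") auto
qed

lemma is_op_zero [simp]: "is_op M op_zero"
  by (simp add: is_op_def op_zero_def)

lemma is_op_one [simp]: "is_op M (op_one M)"
  by (auto simp: is_op_def op_one_def)

lemma is_op_mult [simp]: "is_op M X \<Longrightarrow> is_op M Y \<Longrightarrow> is_op M (X \<odot>\<^bsub>M\<^esub> Y)"
  unfolding is_op_def op_mult_def by (metis (no_types, lifting) mult_eq_0_iff sum.neutral)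

lemma is_op_add [simp]: "is_op M X \<Longrightarrow> is_op M Y \<Longrightarrow> is_op M (X \<oplus> Y)"
  unfolding is_op_def op_add_def by (metis add_0)

lemma is_op_diff [simp]: "is_op M X \<Longrightarrow> is_op M Y \<Longrightarrow> is_op M (op_diff X Y)"
  unfolding is_op_def op_diff_def by (metis diff_0_right)

lemma is_op_scale [simp]: "is_op M X \<Longrightarrow> is_op M (c \<cdot> X)"
  unfolding is_op_def op_scale_def by auto

lemma is_op_adj [simp]: "is_op M X \<Longrightarrow> is_op M (op_adj X)"
  unfolding is_op_def op_adj_def by auto

lemma is_op_sum [simp]: "(\<And>i. i \<in> I \<Longrightarrow> is_op M (f i)) \<Longrightarrow> is_op M (op_sum f I)"
  unfolding is_op_def op_sum_def by (metis (no_types, lifting) sum.neutral)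

lemma is_op_list_prod [simp]: "\<forall>X\<in>set Xs. is_op M X \<Longrightarrow> is_op M (op_list_prod M Xs)"
  by (induction Xs) auto

lemma op_mult_single_column:
  assumes "finite M" "R \<subseteq> M" and "\<And>T. T \<subseteq> M \<Longrightarrow> Y T U = (if T = R then c else 0)"
  shows "(X \<odot>\<^bsub>M\<^esub> Y) S U = c * X S R"
proof -
  have "(X \<odot>\<^bsub>M\<^esub> Y) S U = (\<Sum>T\<in>Pow M. if T = R then c * X S R else 0)"
    unfolding op_mult_def using assms(3) by (intro sum.cong) auto
  then show ?thesis using assms(1,2) by simp
qed

lemma op_mult_zero_column:
  assumes "\<And>T. T \<subseteq> M \<Longrightarrow> Y T U = 0"
  shows "(X \<odot>\<^bsub>M\<^esub> Y) S U = 0"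
  unfolding op_mult_def using assms by (intro sum.neutral) auto

definition diag_op :: "'m set \<Rightarrow> ('m set \<Rightarrow> complex) \<Rightarrow> 'm op" where
  "diag_op M d = (\<lambda>S T. if S = T \<and> S \<subseteq> M then d S else 0)"

lemma is_op_diag [simp]: "is_op M (diag_op M d)"
  by (auto simp: is_op_def diag_op_def)

lemma op_mult_diag_left:
  assumes "finite M" "is_op M X"
  shows "(diag_op M d \<odot>\<^bsub>M\<^esub> X) S T = d S * X S T"
proof -
  have "(diag_op M d \<odot>\<^bsub>M\<^esub> X) S T = (\<Sum>R\<in>Pow M. if R = S then d S * X S T else 0)"
    unfolding op_mult_def by (intro sum.cong) (auto simp: diag_op_def)
  then show ?thesis using assms by (auto simp: is_op_eq_zero)
qed

lemma op_mult_diag_right: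
  assumes "finite M" "is_op M X"
  shows "(X \<odot>\<^bsub>M\<^esub> diag_op M d) S T = d T * X S T"
proof (cases "T \<subseteq> M")
  case True
  then show ?thesis
    using assms(1) by (intro op_mult_single_column) (auto simp: diag_op_def)
next
  case False
  then show ?thesis
    using assms(2) by (subst op_mult_zero_column) (auto simp: diag_op_def is_op_eq_zero)
qed

lemma op_one_eq_diag: "op_one M = diag_op M (\<lambda>_. 1)"
  by (simp add: op_one_def diag_op_def)

lemma op_mult_one_left: "finite M \<Longrightarrow> is_op M X \<Longrightarrow> op_one M \<odot>\<^bsub>M\<^esub> X = X"
  by (intro ext) (simp add: op_one_eq_diag op_mult_diag_left)

lemma op_mult_one_right: "finite M \<Longrightarrow> is_op M X \<Longrightarrow> X \<odot>\<^bsub>M\<^esub> op_one M = X"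
  by (intro ext) (simp add: op_one_eq_diag op_mult_diag_right)

lemma op_list_prod_append:
  assumes "finite M" "\<forall>Y\<in>set Ys. is_op M Y"
  shows "op_list_prod M (Xs @ Ys) = op_list_prod M Xs \<odot>\<^bsub>M\<^esub> op_list_prod M Ys"
  using assms by (induction Xs) (auto simp: op_mult_one_left op_mult_assoc)

lemma op_trace_scale: "op_trace M (c \<cdot> X) = c * op_trace M X"
  by (simp add: op_trace_def op_scale_def sum_distrib_left)

lemma op_trace_sum: "op_trace M (op_sum f I) = (\<Sum>i\<in>I. op_trace M (f i))"
  unfolding op_trace_def op_sum_def by (rule sum.swap)

lemma op_trace_mult_commute: "op_trace M (X \<odot>\<^bsub>M\<^esub> Y) = op_trace M (Y \<odot>\<^bsub>M\<^esub> X)"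
  unfolding op_trace_def op_mult_def by (subst sum.swap) (simp add: mult.commute)

definition ketbra :: "'m set \<Rightarrow> 'm set \<Rightarrow> 'm op" where
  "ketbra S T = (\<lambda>S' T'. if S' = S \<and> T' = T then 1 else 0)"

lemma is_op_ketbra [simp]: "S \<subseteq> M \<Longrightarrow> T \<subseteq> M \<Longrightarrow> is_op M (ketbra S T)"
  by (simp add: is_op_def ketbra_def)

lemma op_mult_ketbra_right:
  assumes "finite M" "S \<subseteq> M"
  shows "(X \<odot>\<^bsub>M\<^esub> ketbra S T) S' T' = (if T' = T then X S' S else 0)"
  using assms op_mult_single_column[of M S "ketbra S T" T 1 X S']
    op_mult_zero_column[of M "ketbra S T" T' X S'] by (auto simp: ketbra_def split: if_splits)

lemma op_eq_sum_ketbra: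
  assumes "finite M" "is_op M X"
  shows "X = op_sum (\<lambda>(S, T). X S T \<cdot> ketbra S T) (Pow M \<times> Pow M)"
proof (intro ext)
  fix S T
  have "op_sum (\<lambda>(S, T). X S T \<cdot> ketbra S T) (Pow M \<times> Pow M) S T
      = (\<Sum>p\<in>Pow M \<times> Pow M. if p = (S, T) then X S T else 0)"
    unfolding op_sum_def by (intro sum.cong) (auto simp: op_scale_def ketbra_def split: if_splits)
  also have "\<dots> = X S T"
    using assms by (auto simp: is_op_eq_zero)
  finally show "X S T = op_sum (\<lambda>(S, T). X S T \<cdot> ketbra S T) (Pow M \<times> Pow M) S T" ..
qed

lemma op_induct_ketbra [consumes 2, case_names ketbra scale add]:
  assumes "finite M" "is_op M X"
    and ketbra: "\<And>S T. S \<subseteq> M \<Longrightarrow> T \<subseteq> M \<Longrightarrow> P (ketbra S T)"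
    and scale: "\<And>c X. is_op M X \<Longrightarrow> P X \<Longrightarrow> P (c \<cdot> X)"
    and add: "\<And>X Y. is_op M X \<Longrightarrow> is_op M Y \<Longrightarrow> P X \<Longrightarrow> P Y \<Longrightarrow> P (X \<oplus> Y)"
  shows "P X"
proof -
  have "P (0 \<cdot> ketbra {} {})"
    by (intro scale ketbra is_op_ketbra) simp_all
  then have "P op_zero"
    by (simp add: op_scale_def op_zero_def)
  then have "is_op M X \<and> P X"
    by (subst (1 2) op_eq_sum_ketbra[OF assms(1,2)],
        intro op_sum_closed[where P = "\<lambda>X. is_op M X \<and> P X"])
      (auto simp: assms(1) ketbra scale add)
  then show ?thesis ..
qed

section \<open>Ladder operators and the anticommutation relations\<close>

definition jw_sign :: "'m::linorder \<Rightarrow> 'm set \<Rightarrow> complex" where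
  "jw_sign i S = (-1) ^ card {j\<in>S. j < i}"

lemma jw_sign_square [simp]: "jw_sign i S * jw_sign i S = 1"
  by (simp add: jw_sign_def flip: power_mult_distrib)

lemma jw_sign_insert:
  assumes "finite S"
  shows "jw_sign i (insert k S) = (if k \<notin> S \<and> k < i then - jw_sign i S else jw_sign i S)"
proof (cases "k \<notin> S \<and> k < i")
  case True
  then have "{j\<in>insert k S. j < i} = insert k {j\<in>S. j < i}" by auto
  with True assms show ?thesis by (simp add: jw_sign_def)
next
  case False
  then have "{j\<in>insert k S. j < i} = {j\<in>S. j < i}" by auto
  with False show ?thesis by (simp add: jw_sign_def)
qed

lemma jw_sign_remove:
  assumes "finite S"
  shows "jw_sign i (S - {k}) = (if k \<in> S \<and> k < i then - jw_sign i S else jw_sign i S)"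
  using jw_sign_insert[of "S - {k}" i k] assms by (cases "k \<in> S") (auto simp: insert_absorb)

lemma ann_apply:
  "ann M i S T = (if i \<in> M \<and> T \<subseteq> M \<and> i \<in> T \<and> S = T - {i} then jw_sign i T else 0)"
  by (simp add: ann_def jw_sign_def)

lemma cre_apply:
  "cre M i S T = (if i \<in> M \<and> T \<subseteq> M \<and> i \<notin> T \<and> S = insert i T then jw_sign i T else 0)"
proof -
  have "{j \<in> insert i T. j < i} = {j \<in> T. j < i}" by auto
  then show ?thesis by (auto simp: cre_def op_adj_def ann_apply jw_sign_def)
qed

lemma is_op_ann [simp]: "is_op M (ann M i)"
  by (auto simp: is_op_def ann_apply)

lemma is_op_cre [simp]: "is_op M (cre M i)"
  by (simp add: cre_def)

lemma op_mult_ann_right: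
  assumes "finite M"
  shows "(X \<odot>\<^bsub>M\<^esub> ann M i) S U = (if i \<in> M \<and> U \<subseteq> M \<and> i \<in> U then jw_sign i U * X S (U - {i}) else 0)"
proof (cases "i \<in> M \<and> U \<subseteq> M \<and> i \<in> U")
  case True
  then show ?thesis
    using assms by (subst op_mult_single_column[of M "U - {i}"]) (auto simp: ann_apply)
next
  case False
  then show ?thesis
    by (subst op_mult_zero_column) (auto simp: ann_apply)
qed

lemma op_mult_cre_right:
  assumes "finite M"
  shows "(X \<odot>\<^bsub>M\<^esub> cre M i) S U = (if i \<in> M \<and> U \<subseteq> M \<and> i \<notin> U then jw_sign i U * X S (insert i U) else 0)"
proof (cases "i \<in> M \<and> U \<subseteq> M \<and> i \<notin> U")
  case True
  then show ?thesis
    using assms by (subst op_mult_single_column[of M "insert i U"]) (auto simp: cre_apply)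
next
  case False
  then show ?thesis
    by (subst op_mult_zero_column) (auto simp: cre_apply)
qed

lemma cre_cre_anticommute:
  assumes "finite M"
  shows "cre M x \<odot>\<^bsub>M\<^esub> cre M y = (-1) \<cdot> (cre M y \<odot>\<^bsub>M\<^esub> cre M x)"
proof (intro ext)
  fix S U
  have "jw_sign y U * jw_sign x (insert y U) = - (jw_sign x U * jw_sign y (insert x U))"
    if "U \<subseteq> M" "x \<notin> U" "y \<notin> U" "x \<noteq> y"
    using that finite_subset[OF that(1) assms]
    by (cases x y rule: linorder_cases) (auto simp: jw_sign_insert)
  then show "(cre M x \<odot>\<^bsub>M\<^esub> cre M y) S U = ((-1) \<cdot> (cre M y \<odot>\<^bsub>M\<^esub> cre M x)) S U"
    using assms by (auto simp: op_scale_def op_mult_cre_right cre_apply insert_commute)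
qed

lemma ann_cre_anticommute:
  assumes "finite M" "x \<in> M" "y \<in> M"
  shows "ann M x \<odot>\<^bsub>M\<^esub> cre M y
    = (if x = y then 1 else 0) \<cdot> op_one M \<oplus> (-1) \<cdot> (cre M y \<odot>\<^bsub>M\<^esub> ann M x)"
proof (intro ext)
  fix S U
  have fin: "finite U" if "U \<subseteq> M" using that assms(1) by (rule finite_subset)
  show "(ann M x \<odot>\<^bsub>M\<^esub> cre M y) S U
    = ((if x = y then 1 else 0) \<cdot> op_one M \<oplus> (-1) \<cdot> (cre M y \<odot>\<^bsub>M\<^esub> ann M x)) S U"
  proof (cases "x = y")
    case True
    then show ?thesis
      using assms fin
      by (auto simp: op_scale_def op_add_def op_one_def op_mult_cre_right op_mult_ann_right
          cre_apply ann_apply jw_sign_insert jw_sign_remove insert_absorb)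
  next
    case False
    then have "insert y U - {x} = insert y (U - {x})" by auto
    then show ?thesis
      using assms fin False
      by (auto simp: op_scale_def op_add_def op_mult_cre_right op_mult_ann_right cre_apply ann_apply
          jw_sign_insert jw_sign_remove)
  qed
qed

lemma ketbra_insert_left:
  assumes "finite M" "i \<in> M" "S \<subseteq> M" "i \<notin> S"
  shows "ketbra (insert i S) T = jw_sign i S \<cdot> (cre M i \<odot>\<^bsub>M\<^esub> ketbra S T)"
  using assms by (auto simp: fun_eq_iff op_scale_def op_mult_ketbra_right cre_apply)
    (auto simp: ketbra_def split: if_splits)

lemma op_induct_cre [consumes 2, case_names vacuum cre scale add]:
  assumes "finite M" "is_op M X"
    and vacuum: "\<And>T. T \<subseteq> M \<Longrightarrow> P (ketbra {} T)"
    and cre: "\<And>i X. i \<in> M \<Longrightarrow> is_op M X \<Longrightarrow> P X \<Longrightarrow> P (cre M i \<odot>\<^bsub>M\<^esub> X)"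
    and scale: "\<And>c X. is_op M X \<Longrightarrow> P X \<Longrightarrow> P (c \<cdot> X)"
    and add: "\<And>X Y. is_op M X \<Longrightarrow> is_op M Y \<Longrightarrow> P X \<Longrightarrow> P Y \<Longrightarrow> P (X \<oplus> Y)"
  shows "P X"
  using assms(1,2)
proof (induction X rule: op_induct_ketbra)
  case (ketbra S T)
  have "finite S" using ketbra(1) assms(1) by (rule finite_subset)
  then show ?case using ketbra
  proof (induction S rule: finite_induct)
    case (insert i S)
    then show ?case
      by (simp add: ketbra_insert_left[OF assms(1)] scale cre)
  qed (rule vacuum)
qed (rule scale add; assumption)+

definition unoccupied :: "'m set \<Rightarrow> 'm set \<Rightarrow> 'm op" where
  "unoccupied M F = diag_op M (\<lambda>S. if S \<inter> F = {} then 1 else 0)"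

lemma is_op_unoccupied [simp]: "is_op M (unoccupied M F)"
  by (simp add: unoccupied_def)

lemma unoccupied_empty: "unoccupied M {} = op_one M"
  by (simp add: unoccupied_def op_one_eq_diag)

lemma unoccupied_insert:
  assumes "finite M" "i \<in> M"
  shows "unoccupied M (insert i F) = (ann M i \<odot>\<^bsub>M\<^esub> cre M i) \<odot>\<^bsub>M\<^esub> unoccupied M F"
  using assms unfolding unoccupied_def
  by (auto simp: fun_eq_iff op_mult_diag_right op_mult_cre_right ann_apply jw_sign_insert finite_subset)
    (auto simp: diag_op_def split: if_splits)

lemma unoccupied_all: "unoccupied M M = ketbra {} {}"
  by (auto simp: fun_eq_iff ketbra_def unoccupied_def diag_op_def)

lemma op_induct_ladder [consumes 2, case_names one ann adj mult scale add]:
  assumes M: "finite M" and "is_op M X"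
    and one: "P (op_one M)"
    and ann: "\<And>i. i \<in> M \<Longrightarrow> P (ann M i)"
    and adj: "\<And>X. is_op M X \<Longrightarrow> P X \<Longrightarrow> P (op_adj X)"
    and mult: "\<And>X Y. is_op M X \<Longrightarrow> is_op M Y \<Longrightarrow> P X \<Longrightarrow> P Y \<Longrightarrow> P (X \<odot>\<^bsub>M\<^esub> Y)"
    and scale: "\<And>c X. is_op M X \<Longrightarrow> P X \<Longrightarrow> P (c \<cdot> X)"
    and add: "\<And>X Y. is_op M X \<Longrightarrow> is_op M Y \<Longrightarrow> P X \<Longrightarrow> P Y \<Longrightarrow> P (X \<oplus> Y)"
  shows "P X"
proof -
  have cre: "P (cre M i)" if "i \<in> M" for i
    using that by (simp add: cre_def adj ann)
  have "P (unoccupied M F)" if "finite F" "F \<subseteq> M" for F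
    using that by (induction F rule: finite_induct)
      (simp_all add: unoccupied_empty unoccupied_insert[OF M] one mult ann cre)
  then have vacuum: "P (ketbra {} {})"
    using M unoccupied_all[of M] by (metis order_refl)
  have ket: "P (ketbra S {})" if "finite S" "S \<subseteq> M" for S
    using that
  proof (induction S rule: finite_induct)
    case (insert i S)
    then show ?case by (simp add: ketbra_insert_left[OF M] scale mult cre)
  qed (rule vacuum)
  show ?thesis using M assms(2)
  proof (induction X rule: op_induct_cre)
    case (vacuum T)
    have "ketbra {} T = op_adj (ketbra T {})"
      by (auto simp: fun_eq_iff ketbra_def op_adj_def)
    then show ?case using vacuum ket[of T] finite_subset[OF vacuum M] by (simp add: adj)
  qed (simp_all add: mult cre scale add)
qed

definition ann_lin :: "'m::linorder set \<Rightarrow> ('m \<Rightarrow> complex) \<Rightarrow> 'm op" where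
  "ann_lin M f = op_sum (\<lambda>x. f x \<cdot> ann M x) M"

definition cre_lin :: "'m::linorder set \<Rightarrow> ('m \<Rightarrow> complex) \<Rightarrow> 'm op" where
  "cre_lin M f = op_sum (\<lambda>x. f x \<cdot> cre M x) M"

lemma is_op_cre_lin [simp]: "is_op M (cre_lin M f)"
  by (simp add: cre_lin_def)

lemma op_adj_ann_lin: "op_adj (ann_lin M f) = cre_lin M (\<lambda>x. cnj (f x))"
  by (simp add: ann_lin_def cre_lin_def cre_def op_adj_def op_sum_def op_scale_def)

lemma op_sum_cre_lin: "op_sum (\<lambda>k. c k \<cdot> cre_lin M (f k)) K = cre_lin M (\<lambda>x. \<Sum>k\<in>K. c k * f k x)"
proof (intro ext)
  fix S T
  have "op_sum (\<lambda>k. c k \<cdot> cre_lin M (f k)) K S T = (\<Sum>k\<in>K. \<Sum>x\<in>M. c k * f k x * cre M x S T)"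
    by (simp add: op_sum_def op_scale_def cre_lin_def sum_distrib_left mult.assoc)
  also have "\<dots> = (\<Sum>x\<in>M. \<Sum>k\<in>K. c k * f k x * cre M x S T)"
    by (rule sum.swap)
  finally show "op_sum (\<lambda>k. c k \<cdot> cre_lin M (f k)) K S T = cre_lin M (\<lambda>x. \<Sum>k\<in>K. c k * f k x) S T"
    by (simp add: op_sum_def op_scale_def cre_lin_def sum_distrib_right)
qed

lemma cre_eq_cre_lin: "finite M \<Longrightarrow> x \<in> M \<Longrightarrow> cre M x = cre_lin M (\<lambda>y. if y = x then 1 else 0)"
  by (simp add: fun_eq_iff cre_lin_def op_sum_def op_scale_def if_distrib[of "\<lambda>c. c * _"] cong: if_cong)

lemma cre_lin_cre_lin_anticommute:
  assumes "finite M"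
  shows "cre_lin M f \<odot>\<^bsub>M\<^esub> cre_lin M g = (-1) \<cdot> (cre_lin M g \<odot>\<^bsub>M\<^esub> cre_lin M f)"
proof (intro ext)
  fix S U
  have cre_cre: "(cre M x \<odot>\<^bsub>M\<^esub> cre M y) S U = - (cre M y \<odot>\<^bsub>M\<^esub> cre M x) S U" for x y
    unfolding cre_cre_anticommute[OF assms, of x y] by (simp add: op_scale_def)
  have "(cre_lin M f \<odot>\<^bsub>M\<^esub> cre_lin M g) S U = (\<Sum>y\<in>M. \<Sum>x\<in>M. f x * g y * (cre M x \<odot>\<^bsub>M\<^esub> cre M y) S U)"
    unfolding cre_lin_def op_mult_linear by (simp add: op_sum_def op_scale_def sum_distrib_left mult_ac)
  also have "\<dots> = (\<Sum>y\<in>M. \<Sum>x\<in>M. - (f x * g y * (cre M y \<odot>\<^bsub>M\<^esub> cre M x) S U))"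
    by (intro sum.cong refl) (subst cre_cre, simp)
  also have "\<dots> = (\<Sum>x\<in>M. \<Sum>y\<in>M. - (f x * g y * (cre M y \<odot>\<^bsub>M\<^esub> cre M x) S U))"
    by (rule sum.swap)
  also have "\<dots> = ((-1) \<cdot> (cre_lin M g \<odot>\<^bsub>M\<^esub> cre_lin M f)) S U"
    unfolding cre_lin_def op_mult_linear
    by (simp add: op_sum_def op_scale_def sum_distrib_left sum_negf mult_ac)
  finally show "(cre_lin M f \<odot>\<^bsub>M\<^esub> cre_lin M g) S U = ((-1) \<cdot> (cre_lin M g \<odot>\<^bsub>M\<^esub> cre_lin M f)) S U" .
qed

lemma ann_lin_cre_lin_anticommute:
  assumes "finite M"
  shows "ann_lin M f \<odot>\<^bsub>M\<^esub> cre_lin M g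
    = (\<Sum>x\<in>M. f x * g x) \<cdot> op_one M \<oplus> (-1) \<cdot> (cre_lin M g \<odot>\<^bsub>M\<^esub> ann_lin M f)"
proof (intro ext)
  fix S U
  have "(ann_lin M f \<odot>\<^bsub>M\<^esub> cre_lin M g) S U = (\<Sum>y\<in>M. \<Sum>x\<in>M. f x * g y * (ann M x \<odot>\<^bsub>M\<^esub> cre M y) S U)"
    unfolding ann_lin_def cre_lin_def op_mult_linear
    by (simp add: op_sum_def op_scale_def sum_distrib_left mult_ac)
  also have "\<dots> = (\<Sum>y\<in>M. \<Sum>x\<in>M. (if x = y then f x * g x * op_one M S U else 0)
      - f x * g y * (cre M y \<odot>\<^bsub>M\<^esub> ann M x) S U)"
    using assms by (intro sum.cong)
      (auto simp: ann_cre_anticommute op_add_def op_scale_def algebra_simps)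
  also have "\<dots> = (\<Sum>y\<in>M. f y * g y) * op_one M S U
      - (\<Sum>y\<in>M. \<Sum>x\<in>M. f x * g y * (cre M y \<odot>\<^bsub>M\<^esub> ann M x) S U)"
    using assms by (simp add: sum_subtractf sum_distrib_right)
  also have "(\<Sum>y\<in>M. \<Sum>x\<in>M. f x * g y * (cre M y \<odot>\<^bsub>M\<^esub> ann M x) S U)
      = (cre_lin M g \<odot>\<^bsub>M\<^esub> ann_lin M f) S U"
    unfolding ann_lin_def cre_lin_def op_mult_linear
    by (subst sum.swap) (simp add: op_sum_def op_scale_def sum_distrib_left mult_ac)
  finally show "(ann_lin M f \<odot>\<^bsub>M\<^esub> cre_lin M g) S U
      = ((\<Sum>x\<in>M. f x * g x) \<cdot> op_one M \<oplus> (-1) \<cdot> (cre_lin M g \<odot>\<^bsub>M\<^esub> ann_lin M f)) S U"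
    by (simp add: op_add_def op_scale_def)
qed

lemma quadratic_cre_lin_commutator:
  assumes "finite M"
  shows "(cre_lin M f \<odot>\<^bsub>M\<^esub> ann_lin M g) \<odot>\<^bsub>M\<^esub> cre_lin M h
    = (cre_lin M h \<odot>\<^bsub>M\<^esub> cre_lin M f \<odot>\<^bsub>M\<^esub> ann_lin M g) \<oplus> (\<Sum>x\<in>M. g x * h x) \<cdot> cre_lin M f"
proof -
  have "(cre_lin M f \<odot>\<^bsub>M\<^esub> ann_lin M g) \<odot>\<^bsub>M\<^esub> cre_lin M h
      = (\<Sum>x\<in>M. g x * h x) \<cdot> cre_lin M f
        \<oplus> (-1) \<cdot> ((cre_lin M f \<odot>\<^bsub>M\<^esub> cre_lin M h) \<odot>\<^bsub>M\<^esub> ann_lin M g)"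
    using assms by (simp add: op_mult_assoc ann_lin_cre_lin_anticommute op_mult_linear op_mult_one_right)
  also have "cre_lin M f \<odot>\<^bsub>M\<^esub> cre_lin M h = (-1) \<cdot> (cre_lin M h \<odot>\<^bsub>M\<^esub> cre_lin M f)"
    using assms by (rule cre_lin_cre_lin_anticommute)
  finally show ?thesis
    by (simp add: op_mult_linear op_mult_assoc op_scale_scale) (simp add: op_add_def add.commute)
qed

lemma diagonal_quadratic_commutator:
  fixes w :: "'k \<Rightarrow> complex"
  assumes M: "finite M" and K: "finite K" "k \<in> K"
    and biorthogonal: "\<And>l. l \<in> K \<Longrightarrow> (\<Sum>x\<in>M. g l x * f k x) = (if l = k then 1 else 0)"
  defines "B \<equiv> op_sum (\<lambda>l. w l \<cdot> (cre_lin M (f l) \<odot>\<^bsub>M\<^esub> ann_lin M (g l))) K"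
  shows "B \<odot>\<^bsub>M\<^esub> cre_lin M (f k) = (cre_lin M (f k) \<odot>\<^bsub>M\<^esub> B) \<oplus> w k \<cdot> cre_lin M (f k)"
proof (intro ext)
  fix S T
  let ?c = "\<lambda>l. cre_lin M (f l)" and ?a = "\<lambda>l. ann_lin M (g l)"
  have "(B \<odot>\<^bsub>M\<^esub> ?c k) S T = (\<Sum>l\<in>K. w l * ((?c l \<odot>\<^bsub>M\<^esub> ?a l) \<odot>\<^bsub>M\<^esub> ?c k) S T)"
    unfolding B_def op_mult_linear by (simp add: op_sum_def op_scale_def)
  also have "\<dots> = (\<Sum>l\<in>K. w l * (?c k \<odot>\<^bsub>M\<^esub> ?c l \<odot>\<^bsub>M\<^esub> ?a l) S T + (if l = k then w k * ?c k S T else 0))"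
  proof (intro sum.cong refl)
    fix l assume "l \<in> K"
    then show "w l * ((?c l \<odot>\<^bsub>M\<^esub> ?a l) \<odot>\<^bsub>M\<^esub> ?c k) S T
        = w l * (?c k \<odot>\<^bsub>M\<^esub> ?c l \<odot>\<^bsub>M\<^esub> ?a l) S T + (if l = k then w k * ?c k S T else 0)"
      unfolding quadratic_cre_lin_commutator[OF M] biorthogonal[OF \<open>l \<in> K\<close>]
      by (simp add: op_add_def op_scale_def distrib_left)
  qed
  also have "\<dots> = (\<Sum>l\<in>K. w l * (?c k \<odot>\<^bsub>M\<^esub> ?c l \<odot>\<^bsub>M\<^esub> ?a l) S T) + w k * ?c k S T"
    unfolding sum.distrib using K by simp
  finally show "(B \<odot>\<^bsub>M\<^esub> ?c k) S T = ((?c k \<odot>\<^bsub>M\<^esub> B) \<oplus> w k \<cdot> ?c k) S T"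
    unfolding B_def op_mult_linear by (simp add: op_sum_def op_scale_def op_add_def)
qed

section \<open>Exponentials\<close>

text \<open>Vectors are the columns of \<open>Z\<close>. On eigenvectors only the scalar exponential series matters, so
  no convergence estimate for operators is needed.\<close>

inductive exp_eigenspan :: "'m set \<Rightarrow> 'm op \<Rightarrow> 'm op \<Rightarrow> 'm op \<Rightarrow> bool" for M X W where
  eigen: "is_op M Z \<Longrightarrow> X \<odot>\<^bsub>M\<^esub> Z = \<mu> \<cdot> Z \<Longrightarrow> W \<odot>\<^bsub>M\<^esub> Z = exp \<mu> \<cdot> Z \<Longrightarrow> exp_eigenspan M X W Z"
| scale: "exp_eigenspan M X W Z \<Longrightarrow> exp_eigenspan M X W (c \<cdot> Z)"
| add: "exp_eigenspan M X W Y \<Longrightarrow> exp_eigenspan M X W Z \<Longrightarrow> exp_eigenspan M X W (Y \<oplus> Z)"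

lemma exp_eigenspan_sum:
  assumes "finite I" "\<And>i. i \<in> I \<Longrightarrow> exp_eigenspan M X W (f i)"
  shows "exp_eigenspan M X W (op_sum f I)"
proof -
  have "exp_eigenspan M X W op_zero"
    by (rule exp_eigenspan.eigen[where \<mu> = 0])
      (simp_all, simp_all add: op_mult_def op_zero_def op_scale_def)
  with assms(1) show ?thesis
    using exp_eigenspan.add assms(2) by (rule op_sum_closed[where P = "exp_eigenspan M X W"])
qed

lemma exp_eigenspan_ladder:
  assumes "exp_eigenspan M X W Z" "is_op M C"
    and XC: "X \<odot>\<^bsub>M\<^esub> C = (C \<odot>\<^bsub>M\<^esub> X) \<oplus> l \<cdot> C"
    and WC: "W \<odot>\<^bsub>M\<^esub> C = exp l \<cdot> (C \<odot>\<^bsub>M\<^esub> W)"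
  shows "exp_eigenspan M X W (C \<odot>\<^bsub>M\<^esub> Z)"
  using assms(1)
proof (induction Z)
  case (eigen Z \<mu>)
  have "X \<odot>\<^bsub>M\<^esub> C \<odot>\<^bsub>M\<^esub> Z = (\<mu> + l) \<cdot> (C \<odot>\<^bsub>M\<^esub> Z)"
    using eigen(2) unfolding op_mult_assoc[symmetric] XC op_mult_linear
    by (simp add: op_mult_assoc op_mult_linear) (simp add: op_add_def op_scale_def distrib_right)
  moreover have "W \<odot>\<^bsub>M\<^esub> C \<odot>\<^bsub>M\<^esub> Z = exp (\<mu> + l) \<cdot> (C \<odot>\<^bsub>M\<^esub> Z)"
    using eigen(3) unfolding op_mult_assoc[symmetric] WC op_mult_linear
    by (simp add: op_mult_assoc op_mult_linear op_scale_scale exp_add mult.commute)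
  ultimately show ?case
    using eigen(1) assms(2) by (intro exp_eigenspan.eigen) simp_all
qed (auto simp: op_mult_linear intro: exp_eigenspan.scale exp_eigenspan.add)

lemma exp_eigenspan_sums:
  assumes "finite M" "exp_eigenspan M X W Z"
  shows "(\<lambda>n. (op_pow M X n \<odot>\<^bsub>M\<^esub> Z) S T / of_nat (fact n)) sums (W \<odot>\<^bsub>M\<^esub> Z) S T"
  using assms(2)
proof (induction Z)
  case (eigen Z \<mu>)
  have "op_pow M X n \<odot>\<^bsub>M\<^esub> Z = \<mu> ^ n \<cdot> Z" for n
    by (induction n)
      (simp_all add: assms(1) eigen op_mult_one_left op_mult_assoc op_mult_scale_right op_scale_scale
        mult.commute)
  moreover have "(\<lambda>n. \<mu> ^ n / of_nat (fact n)) sums exp \<mu>"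
    using exp_converges[of \<mu>] by (simp add: scaleR_conv_of_real field_simps)
  then have "(\<lambda>n. \<mu> ^ n / of_nat (fact n) * Z S T) sums (exp \<mu> * Z S T)"
    by (rule sums_mult2)
  ultimately show ?case
    by (simp add: eigen op_scale_def)
next
  case (scale Z c)
  then show ?case
    using sums_mult[OF scale.IH, of c] unfolding op_mult_linear by (simp add: op_scale_def)
next
  case (add Y Z)
  then show ?case
    using sums_add[OF add.IH] unfolding op_mult_linear by (simp add: op_add_def add_divide_distrib)
qed

lemma is_op_pow [simp]: "is_op M X \<Longrightarrow> is_op M (op_pow M X n)"
  by (induction n) auto

lemma op_exp_eqI:
  assumes "finite M" "is_op M X" "is_op M W" "exp_eigenspan M X W (op_one M)"
  shows "op_exp M X = W"
  using sums_unique[OF exp_eigenspan_sums[OF assms(1,4)]] assms(1-3)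
  by (simp add: fun_eq_iff op_exp_def op_mult_one_right)

lemma op_exp_diag:
  assumes "finite M"
  shows "op_exp M (diag_op M d) = diag_op M (\<lambda>S. exp (d S))"
proof (rule op_exp_eqI)
  show "exp_eigenspan M (diag_op M d) (diag_op M (\<lambda>S. exp (d S))) (op_one M)"
    using assms is_op_one
  proof (induction rule: op_induct_ketbra)
    case (ketbra S T)
    then show ?case
      using assms by (intro exp_eigenspan.eigen[where \<mu> = "d S"])
        (auto simp: fun_eq_iff op_mult_diag_left op_scale_def, auto simp: ketbra_def split: if_splits)
  qed (intro exp_eigenspan.scale exp_eigenspan.add; assumption)+
qed (use assms in auto)

lemma op_exp_eqI_ladder:
  assumes M: "finite M" and "is_op M X" "is_op M W"
    and X_vacuum: "\<And>S. X S {} = 0" and W_vacuum: "\<And>S. W S {} = (if S = {} then 1 else 0)"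
    and "finite K" and C: "\<And>k. k \<in> K \<Longrightarrow> is_op M (C k)"
    and XC: "\<And>k. k \<in> K \<Longrightarrow> X \<odot>\<^bsub>M\<^esub> C k = (C k \<odot>\<^bsub>M\<^esub> X) \<oplus> l k \<cdot> C k"
    and WC: "\<And>k. k \<in> K \<Longrightarrow> W \<odot>\<^bsub>M\<^esub> C k = exp (l k) \<cdot> (C k \<odot>\<^bsub>M\<^esub> W)"
    and span: "\<And>x. x \<in> M \<Longrightarrow> cre M x = op_sum (\<lambda>k. c x k \<cdot> C k) K"
  shows "op_exp M X = W"
proof (rule op_exp_eqI)
  show "exp_eigenspan M X W (op_one M)"
    using M is_op_one
  proof (induction rule: op_induct_cre)
    case (vacuum T)
    have "X \<odot>\<^bsub>M\<^esub> ketbra {} T = 0 \<cdot> ketbra {} T" "W \<odot>\<^bsub>M\<^esub> ketbra {} T = exp 0 \<cdot> ketbra {} T"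
      using M by (simp_all add: fun_eq_iff op_mult_ketbra_right X_vacuum W_vacuum op_scale_def)
        (simp add: ketbra_def)
    then show ?case
      using vacuum by (intro exp_eigenspan.eigen[where \<mu> = 0]) simp_all
  next
    case (cre x Z)
    have "exp_eigenspan M X W (C k \<odot>\<^bsub>M\<^esub> Z)" if "k \<in> K" for k
      using cre(3) C[OF that] XC[OF that] WC[OF that] by (rule exp_eigenspan_ladder)
    then show ?case
      unfolding span[OF cre(1)] op_mult_linear
      by (intro exp_eigenspan_sum \<open>finite K\<close> exp_eigenspan.scale)
  qed (intro exp_eigenspan.scale exp_eigenspan.add; assumption)+
qed (use assms in auto)

lemma number_op_eq_diag:
  assumes "finite M"
  shows "number_op M = diag_op M (\<lambda>S. of_nat (card S))"
proof (intro ext)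
  fix S T
  have "number_op M S T = (\<Sum>i\<in>M. if i \<in> S then if S = T \<and> S \<subseteq> M then 1 else 0 else 0)"
    unfolding number_op_def op_sum_def using assms
    by (intro sum.cong) (auto simp: op_mult_ann_right cre_apply jw_sign_remove finite_subset)
  also have "\<dots> = diag_op M (\<lambda>S. of_nat (card S)) S T"
    using assms by (auto simp: diag_op_def Int_absorb1 sum.If_cases simp flip: sum.inter_restrict)
  finally show "number_op M S T = diag_op M (\<lambda>S. of_nat (card S)) S T" .
qed

lemma parity_op_eq_diag:
  assumes "finite M"
  shows "parity_op M = diag_op M (\<lambda>S. (-1) ^ card S)"
proof -
  have "exp (\<i> * of_real pi * of_nat n) = (-1) ^ n" for n
    by (metis exp_of_nat2_mult exp_pi_i')
  moreover have "(\<i> * of_real pi) \<cdot> number_op M = diag_op M (\<lambda>S. \<i> * of_real pi * of_nat (card S))"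
    unfolding number_op_eq_diag[OF assms] by (auto simp: fun_eq_iff op_scale_def diag_op_def)
  ultimately show ?thesis
    by (simp add: parity_op_def op_exp_diag[OF assms])
qed

section \<open>Operators on a single slice\<close>

definition layer :: "'i \<Rightarrow> ('i \<times> 'a) set \<Rightarrow> 'a set" where
  "layer t S = {i. (t, i) \<in> S}"

definition off_layer :: "'i \<Rightarrow> ('i \<times> 'a) set \<Rightarrow> ('i \<times> 'a) set" where
  "off_layer t S = {x\<in>S. fst x \<noteq> t}"

definition card_below :: "'i::linorder \<Rightarrow> ('i \<times> 'a) set \<Rightarrow> nat" where
  "card_below t S = card {x\<in>S. fst x < t}"

definition set_layer :: "'i \<Rightarrow> 'a set \<Rightarrow> ('i \<times> 'a) set \<Rightarrow> ('i \<times> 'a) set" where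
  "set_layer t R S = off_layer t S \<union> {t} \<times> R"

lemma layer_subset: "S \<subseteq> I \<times> A \<Longrightarrow> layer t S \<subseteq> A"
  by (auto simp: layer_def)

lemma finite_layer: "finite S \<Longrightarrow> finite (layer t S)"
  using finite_vimageI[of S "Pair t"] by (simp add: layer_def vimage_def inj_on_def)

lemma layer_set_layer [simp]: "layer u (set_layer t R S) = (if u = t then R else layer u S)"
  by (auto simp: layer_def set_layer_def off_layer_def)

lemma off_layer_set_layer [simp]: "off_layer t (set_layer t R S) = off_layer t S"
  by (auto simp: set_layer_def off_layer_def)

lemma set_layer_subset: "t \<in> I \<Longrightarrow> S \<subseteq> I \<times> A \<Longrightarrow> R \<subseteq> A \<Longrightarrow> set_layer t R S \<subseteq> I \<times> A"
  by (auto simp: set_layer_def off_layer_def)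

lemma layers_eqI: "(\<And>t. layer t S = layer t T) \<Longrightarrow> S = T"
  by (auto simp: layer_def)

lemma off_layer_eq_iff: "off_layer t S = off_layer t T \<longleftrightarrow> (\<forall>u. u \<noteq> t \<longrightarrow> layer u S = layer u T)"
  unfolding off_layer_def layer_def set_eq_iff by auto

lemma eq_iff_off_layer: "S = T \<longleftrightarrow> off_layer t S = off_layer t T \<and> layer t S = layer t T"
  by (metis layers_eqI off_layer_eq_iff)

lemma card_below_cong:
  assumes "\<And>u. u < t \<Longrightarrow> layer u S = layer u T"
  shows "card_below t S = card_below t T"
proof -
  have "{x\<in>S. fst x < t} = {x\<in>T. fst x < t}"
    using assms unfolding layer_def set_eq_iff by auto
  then show ?thesis by (simp only: card_below_def)
qed

lemma card_below_off_layer_cong: "off_layer t S = off_layer t T \<Longrightarrow> card_below t S = card_below t T"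
  unfolding off_layer_eq_iff by (rule card_below_cong) auto

lemma card_below_eq_off_plus_layer:
  assumes "finite S" "t < u"
  shows "card_below u S = card_below u (off_layer t S) + card (layer t S)"
proof -
  have "{x\<in>S. fst x < u} = {x\<in>off_layer t S. fst x < u} \<union> Pair t ` layer t S"
    using assms(2) by (auto simp: off_layer_def layer_def)
  moreover have "{x\<in>off_layer t S. fst x < u} \<inter> Pair t ` layer t S = {}"
    by (auto simp: off_layer_def)
  moreover have "finite {x\<in>off_layer t S. fst x < u}"
    using assms(1) by (simp add: off_layer_def)
  ultimately show ?thesis
    using finite_layer[OF assms(1)] by (simp add: card_below_def card_Un_disjoint card_image inj_on_def)
qed

lemma jw_sign_Pair:
  assumes "finite S"
  shows "jw_sign (t, i) S = (-1) ^ card_below t S * jw_sign i (layer t S)"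
proof -
  have "{x\<in>S. x < (t, i)} = {x\<in>S. fst x < t} \<union> Pair t ` {j\<in>layer t S. j < i}"
    by (auto simp: layer_def less_prod_def image_iff)
  moreover have "{x\<in>S. fst x < t} \<inter> Pair t ` {j\<in>layer t S. j < i} = {}" by auto
  ultimately have "card {x\<in>S. x < (t, i)} = card_below t S + card {j\<in>layer t S. j < i}"
    using assms finite_layer[OF assms, of t]
    by (simp add: card_Un_disjoint card_below_def card_image inj_on_def)
  then show ?thesis by (simp add: jw_sign_def power_add)
qed

lemma sum_Pow_off_layer_eq:
  assumes "finite I" "finite A" "t \<in> I" "S \<subseteq> I \<times> A"
  shows "(\<Sum>T\<in>Pow (I \<times> A). if off_layer t T = off_layer t S then f T else 0)
    = (\<Sum>R\<in>Pow A. f (set_layer t R S))"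
proof -
  have "(\<Sum>T\<in>Pow (I \<times> A). if off_layer t T = off_layer t S then f T else 0)
      = (\<Sum>T\<in>{T\<in>Pow (I \<times> A). off_layer t T = off_layer t S}. f T)"
    using assms(1,2) by (intro sum.inter_filter[symmetric]) simp
  also have "\<dots> = (\<Sum>R\<in>Pow A. f (set_layer t R S))"
  proof (rule sum.reindex_bij_witness[where i = "\<lambda>R. set_layer t R S" and j = "layer t"])
    fix T assume "T \<in> {T \<in> Pow (I \<times> A). off_layer t T = off_layer t S}"
    then have T: "T \<subseteq> I \<times> A" "off_layer t T = off_layer t S" by auto
    show "set_layer t (layer t T) S = T"
      using T(2) by (intro layers_eqI) (auto simp: off_layer_eq_iff)
    then show "f (set_layer t (layer t T) S) = f T" by simp
    show "layer t T \<in> Pow A" using layer_subset[OF T(1)] by simp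
  next
    fix R assume "R \<in> Pow A"
    then show "set_layer t R S \<in> {T \<in> Pow (I \<times> A). off_layer t T = off_layer t S}"
      using set_layer_subset[OF assms(3,4), of R] by simp
  qed simp
  finally show ?thesis .
qed

lemma minus_one_power_cong: "even (a + b) \<Longrightarrow> (-1) ^ a = ((-1) ^ b :: 'r::ring_1)"
  by (auto simp: minus_one_power_iff)

text \<open>Each ladder operator applied on slice \<open>t\<close> passes the particles of the lower slices.\<close>

definition layer_sign :: "'i::linorder \<Rightarrow> ('i \<times> 'a) set \<Rightarrow> 'a set \<Rightarrow> complex" where
  "layer_sign t S R = (-1) ^ ((card (layer t S) + card R) * card_below t S)"

lemma layer_sign_commute:
  assumes "off_layer t S = off_layer t T"
  shows "layer_sign t S (layer t T) = layer_sign t T (layer t S)"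
  using card_below_off_layer_cong[OF assms] by (simp add: layer_sign_def add.commute)

lemma layer_sign_trans: "layer_sign t S R * layer_sign t (set_layer t R S) Q = layer_sign t S Q"
proof -
  have "card_below t (set_layer t R S) = card_below t S"
    by (rule card_below_off_layer_cong) simp
  then show ?thesis
    unfolding layer_sign_def power_add[symmetric] by (intro minus_one_power_cong) auto
qed

definition place :: "'i::linorder set \<Rightarrow> 'a set \<Rightarrow> 'i \<Rightarrow> 'a op \<Rightarrow> ('i \<times> 'a) op" where
  "place I A t X = (\<lambda>S T. if S \<subseteq> I \<times> A \<and> T \<subseteq> I \<times> A \<and> off_layer t S = off_layer t T
     then layer_sign t S (layer t T) * X (layer t S) (layer t T) else 0)"

lemma is_op_place [simp]: "is_op (I \<times> A) (place I A t X)"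
  by (simp add: is_op_def place_def)

lemma place_mult_apply:
  assumes "finite I" "finite A" "t \<in> I" "S \<subseteq> I \<times> A"
  shows "(place I A t X \<odot>\<^bsub>I \<times> A\<^esub> Z) S U
    = (\<Sum>R\<in>Pow A. layer_sign t S R * X (layer t S) R * Z (set_layer t R S) U)"
proof -
  have "(place I A t X \<odot>\<^bsub>I \<times> A\<^esub> Z) S U = (\<Sum>T\<in>Pow (I \<times> A). if off_layer t T = off_layer t S
      then layer_sign t S (layer t T) * X (layer t S) (layer t T) * Z T U else 0)"
    unfolding op_mult_def using assms(4) by (intro sum.cong) (auto simp: place_def)
  then show ?thesis by (simp add: sum_Pow_off_layer_eq[OF assms])
qed

lemma place_mult_local:
  assumes "finite I" "finite A" "t \<in> I" "S \<subseteq> I \<times> A" "U \<subseteq> I \<times> A"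
    and Z: "\<And>T. T \<subseteq> I \<times> A \<Longrightarrow> Z T U \<noteq> 0 \<Longrightarrow> layer t T = layer t U"
  shows "(place I A t X \<odot>\<^bsub>I \<times> A\<^esub> Z) S U
    = layer_sign t S (layer t U) * X (layer t S) (layer t U) * Z (set_layer t (layer t U) S) U"
    (is "_ = ?entry (layer t U)")
proof -
  have "Z (set_layer t R S) U = 0" if "R \<subseteq> A" "R \<noteq> layer t U" for R
    using Z[OF set_layer_subset[OF assms(3,4) that(1)]] that(2) by auto
  then have "(place I A t X \<odot>\<^bsub>I \<times> A\<^esub> Z) S U = (\<Sum>R\<in>Pow A. if R = layer t U then ?entry (layer t U) else 0)"
    unfolding place_mult_apply[OF assms(1-4)] by (intro sum.cong) auto
  then show ?thesis
    using assms(2) layer_subset[OF assms(5)] by simp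
qed

lemma place_mult:
  assumes "finite I" "finite A" "t \<in> I"
  shows "place I A t (X \<odot>\<^bsub>A\<^esub> Y) = place I A t X \<odot>\<^bsub>I \<times> A\<^esub> place I A t Y"
proof (intro ext)
  fix S U
  show "place I A t (X \<odot>\<^bsub>A\<^esub> Y) S U = (place I A t X \<odot>\<^bsub>I \<times> A\<^esub> place I A t Y) S U"
  proof (cases "S \<subseteq> I \<times> A \<and> U \<subseteq> I \<times> A \<and> off_layer t S = off_layer t U")
    case True
    have "place I A t Y (set_layer t R S) U
        = layer_sign t (set_layer t R S) (layer t U) * Y R (layer t U)"
      if "R \<subseteq> A" for R
      using True that assms(3) set_layer_subset[of t I S A R] by (simp add: place_def)
    then have "(place I A t X \<odot>\<^bsub>I \<times> A\<^esub> place I A t Y) S U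
        = (\<Sum>R\<in>Pow A. (layer_sign t S R * layer_sign t (set_layer t R S) (layer t U))
            * (X (layer t S) R * Y R (layer t U)))"
      unfolding place_mult_apply[OF assms conjunct1[OF True]] by (intro sum.cong) simp_all
    also have "\<dots> = place I A t (X \<odot>\<^bsub>A\<^esub> Y) S U"
      unfolding layer_sign_trans using True by (simp add: place_def op_mult_def sum_distrib_left)
    finally show ?thesis ..
  next
    case False
    then have "place I A t X S T * place I A t Y T U = 0" for T
      by (auto simp: place_def)
    then have "(place I A t X \<odot>\<^bsub>I \<times> A\<^esub> place I A t Y) S U = 0"
      unfolding op_mult_def by (intro sum.neutral) blast
    moreover have "place I A t (X \<odot>\<^bsub>A\<^esub> Y) S U = 0"
      unfolding place_def using False by (rule if_not_P)
    ultimately show ?thesis by simp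
  qed
qed

lemma place_one: "place I A t (op_one A) = op_one (I \<times> A)"
proof (intro ext)
  fix S T
  show "place I A t (op_one A) S T = op_one (I \<times> A) S T"
    using eq_iff_off_layer[of S T t] by (auto simp: place_def op_one_def layer_subset layer_sign_def)
qed

lemma place_add: "place I A t (X \<oplus> Y) = place I A t X \<oplus> place I A t Y"
  by (auto simp: place_def op_add_def fun_eq_iff distrib_left)

lemma place_scale: "place I A t (c \<cdot> X) = c \<cdot> place I A t X"
  by (auto simp: place_def op_scale_def fun_eq_iff)

lemma place_adj: "place I A t (op_adj X) = op_adj (place I A t X)"
proof (intro ext)
  fix S T
  show "place I A t (op_adj X) S T = op_adj (place I A t X) S T"
    using layer_sign_commute[of t T S] by (auto simp: place_def op_adj_def layer_sign_def)
qed

lemma eq_remove_Pair_iff: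
  "S = T - {(t, i)} \<longleftrightarrow> off_layer t S = off_layer t T \<and> layer t S = layer t T - {i}"
proof -
  have "off_layer t (T - {(t, i)}) = off_layer t T" "layer t (T - {(t, i)}) = layer t T - {i}"
    by (auto simp: off_layer_def layer_def)
  then show ?thesis using eq_iff_off_layer[of S "T - {(t, i)}" t] by simp
qed

lemma place_ann:
  assumes "finite I" "finite A" "t \<in> I" "i \<in> A"
  shows "place I A t (ann A i) = ann (I \<times> A) (t, i)"
proof (intro ext)
  fix S T
  show "place I A t (ann A i) S T = ann (I \<times> A) (t, i) S T"
  proof (cases "T \<subseteq> I \<times> A \<and> i \<in> layer t T \<and> S = T - {(t, i)}")
    case True
    then have fin: "finite T" using assms(1,2) finite_subset by blast
    have S: "S \<subseteq> I \<times> A" "off_layer t S = off_layer t T" "layer t S = layer t T - {i}"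
      using True eq_remove_Pair_iff[of S T t i] by auto
    have "card (layer t T) = Suc (card (layer t S))"
      unfolding S(3) using True finite_layer[OF fin] by (simp only: card_Suc_Diff1)
    then have "layer_sign t S (layer t T) = (-1) ^ card_below t T"
      unfolding layer_sign_def card_below_off_layer_cong[OF S(2)] by (intro minus_one_power_cong) simp
    then show ?thesis
      using True S assms layer_subset[of T I A t]
      by (simp add: place_def ann_apply jw_sign_Pair[OF fin]) (simp add: layer_def)
  next
    case False
    then have "\<not> (T \<subseteq> I \<times> A \<and> off_layer t S = off_layer t T
        \<and> i \<in> layer t T \<and> layer t S = layer t T - {i})"
      unfolding eq_remove_Pair_iff by blast
    then have "place I A t (ann A i) S T = 0"
      unfolding place_def ann_apply by (simp split: if_split) blast
    moreover have "ann (I \<times> A) (t, i) S T = 0"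
      unfolding ann_apply using False by (intro if_not_P) (auto simp: layer_def)
    ultimately show ?thesis by simp
  qed
qed

lemma unital_star_hom_eqI:
  fixes \<phi> \<psi> :: "'a::linorder op \<Rightarrow> 'b op"
  assumes "finite A" and \<phi>: "unital_star_hom A B \<phi>" and \<psi>: "unital_star_hom A B \<psi>"
    and ann: "\<And>i. i \<in> A \<Longrightarrow> \<phi> (ann A i) = \<psi> (ann A i)"
  shows "\<phi> = \<psi>"
proof
  fix X
  show "\<phi> X = \<psi> X"
  proof (cases "is_op A X")
    case True
    with assms(1) show ?thesis
      by (induction rule: op_induct_ladder) (use \<phi> \<psi> ann in \<open>simp_all add: unital_star_hom_def\<close>)
  next
    case False
    then show ?thesis using \<phi> \<psi> by (simp add: unital_star_hom_def)
  qed
qed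

lemma modes_H_eq: "modes_H N L = {0..<N} \<times> modes_h L"
  by (simp add: modes_H_def modes_h_def)

lemma finite_modes_h [simp]: "finite (modes_h L)"
  by (simp add: modes_h_def)

lemma slice_eq_place:
  assumes "t < N" "is_op (modes_h L) X"
  shows "slice N L t X = place {0..<N} (modes_h L) t X"
proof -
  let ?\<phi> = "\<lambda>X. if is_op (modes_h L) X then place {0..<N} (modes_h L) t X else op_zero"
  let ?P = "\<lambda>\<phi>. unital_star_hom (modes_h L) (modes_H N L) \<phi> \<and>
       (\<forall>i\<in>{1..L}. \<phi> (ann (modes_h L) i) = ann (modes_H N L) (t, i))"
  have "?P ?\<phi>"
    unfolding unital_star_hom_def modes_H_eq using assms(1)
    by (auto simp: place_add place_scale place_mult place_one place_adj place_ann modes_h_def)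
  moreover have "\<psi> = ?\<phi>" if "?P \<psi>" for \<psi>
    using that \<open>?P ?\<phi>\<close>
    by (intro unital_star_hom_eqI[of "modes_h L" "modes_H N L"]) (auto simp: modes_h_def)
  ultimately have "(THE \<phi>. ?P \<phi>) = ?\<phi>"
    by (rule the_equality)
  then show ?thesis
    unfolding slice_def using assms(2) by simp
qed

definition has_parity :: "bool \<Rightarrow> 'm op \<Rightarrow> bool" where
  "has_parity p X \<longleftrightarrow> (\<forall>S T. X S T \<noteq> 0 \<longrightarrow> odd (card S + card T) = p)"

lemma place_place_apply:
  assumes "finite I" "finite A" "t \<in> I" "t \<noteq> u" "S \<subseteq> I \<times> A" "U \<subseteq> I \<times> A"
  shows "(place I A t X \<odot>\<^bsub>I \<times> A\<^esub> place I A u Y) S U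
    = (if \<forall>v. v \<noteq> t \<and> v \<noteq> u \<longrightarrow> layer v S = layer v U
       then layer_sign t S (layer t U) * layer_sign u U (layer u S)
         * (X (layer t S) (layer t U) * Y (layer u S) (layer u U)) else 0)"
proof -
  let ?R = "set_layer t (layer t U) S"
  have "layer t T = layer t U" if "place I A u Y T U \<noteq> 0" for T
    using that assms(4) by (auto simp: place_def off_layer_eq_iff split: if_splits)
  then have localized: "(place I A t X \<odot>\<^bsub>I \<times> A\<^esub> place I A u Y) S U
      = layer_sign t S (layer t U) * X (layer t S) (layer t U) * place I A u Y ?R U"
    using assms by (intro place_mult_local) auto
  have "?R \<subseteq> I \<times> A"
    using assms by (intro set_layer_subset layer_subset)
  moreover have "off_layer u ?R = off_layer u U \<longleftrightarrow> (\<forall>v. v \<noteq> t \<and> v \<noteq> u \<longrightarrow> layer v S = layer v U)"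
    by (auto simp: off_layer_eq_iff)
  moreover have "layer_sign u ?R (layer u U) = layer_sign u U (layer u S)"
    if "off_layer u ?R = off_layer u U"
    using layer_sign_commute[OF that] assms(4) by simp
  ultimately show ?thesis
    unfolding localized using assms(4,6) by (auto simp: place_def)
qed

lemma even_card_below_change:
  assumes "finite S" "finite U" "t < u" "\<And>v. v < u \<Longrightarrow> v \<noteq> t \<Longrightarrow> layer v S = layer v U"
  shows "even (card_below u S + card_below u U) \<longleftrightarrow> even (card (layer t S) + card (layer t U))"
proof -
  have "card_below u (off_layer t S) = card_below u (off_layer t U)"
    by (rule card_below_cong) (use assms(4) in \<open>auto simp: layer_def off_layer_def\<close>)
  then show ?thesis
    using assms(1-3) by (auto simp: card_below_eq_off_plus_layer)
qed

lemma place_commute_less: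
  fixes I :: "'i::linorder set" and A :: "'a set"
  assumes fin: "finite I" "finite A" and "t \<in> I" "u \<in> I" "t < u"
    and parity: "has_parity p X" "has_parity q Y"
  shows "place I A t X \<odot>\<^bsub>I \<times> A\<^esub> place I A u Y
    = (if p \<and> q then -1 else 1) \<cdot> (place I A u Y \<odot>\<^bsub>I \<times> A\<^esub> place I A t X)"
proof (rule op_eqI[where M = "I \<times> A"])
  fix S U :: "('i \<times> 'a) set"
  assume SU: "S \<subseteq> I \<times> A" "U \<subseteq> I \<times> A"
  let ?agree = "\<forall>v. v \<noteq> t \<and> v \<noteq> u \<longrightarrow> layer v S = layer v U"
  let ?x = "X (layer t S) (layer t U)" and ?y = "Y (layer u S) (layer u U)"
  have ordered: "(place I A t X \<odot>\<^bsub>I \<times> A\<^esub> place I A u Y) S U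
      = (if ?agree then layer_sign t S (layer t U) * layer_sign u U (layer u S) * (?x * ?y) else 0)"
    using place_place_apply[of I A t u S U X Y] SU assms(3-5) fin by simp
  have exchanged: "(place I A u Y \<odot>\<^bsub>I \<times> A\<^esub> place I A t X) S U
      = (if ?agree then layer_sign u S (layer u U) * layer_sign t U (layer t S) * (?x * ?y) else 0)"
    using place_place_apply[of I A u t S U Y X] SU assms(3-5) fin by (auto simp: mult.commute[of ?y])
  have signs: "layer_sign t S (layer t U) * layer_sign u U (layer u S)
      = (if p \<and> q then -1 else 1) * (layer_sign u S (layer u U) * layer_sign t U (layer t S))"
    if agree: ?agree and nonzero: "?x \<noteq> 0" "?y \<noteq> 0"
  proof -
    have "finite S" "finite U" using SU fin finite_subset by blast+
    then have "even (card_below u S + card_below u U) = even (card (layer t S) + card (layer t U))"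
      using agree \<open>t < u\<close> by (intro even_card_below_change) auto
    moreover have "card_below t S = card_below t U"
      using agree \<open>t < u\<close> by (intro card_below_cong) auto
    moreover have "even (card (layer t S) + card (layer t U)) = (\<not> p)"
      "even (card (layer u S) + card (layer u U)) = (\<not> q)"
      using parity nonzero unfolding has_parity_def by auto
    ultimately show ?thesis
      by (auto simp: layer_sign_def minus_one_power_iff)
  qed
  show "(place I A t X \<odot>\<^bsub>I \<times> A\<^esub> place I A u Y) S U
    = ((if p \<and> q then -1 else 1) \<cdot> (place I A u Y \<odot>\<^bsub>I \<times> A\<^esub> place I A t X)) S U"
    unfolding op_scale_def ordered exchanged
    by (cases "?agree \<and> ?x \<noteq> 0 \<and> ?y \<noteq> 0") (use signs in auto)
qed simp_all

lemma place_commute: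
  assumes "finite I" "finite A" "t \<in> I" "u \<in> I" "t \<noteq> u" "has_parity p X" "has_parity q Y"
  shows "place I A t X \<odot>\<^bsub>I \<times> A\<^esub> place I A u Y
    = (if p \<and> q then -1 else 1) \<cdot> (place I A u Y \<odot>\<^bsub>I \<times> A\<^esub> place I A t X)"
proof (cases "t < u")
  case True
  with assms place_commute_less show ?thesis by blast
next
  case False
  then have "place I A u Y \<odot>\<^bsub>I \<times> A\<^esub> place I A t X
    = (if q \<and> p then -1 else 1) \<cdot> (place I A t X \<odot>\<^bsub>I \<times> A\<^esub> place I A u Y)"
    using assms by (intro place_commute_less) auto
  then show ?thesis by (auto simp: op_scale_scale)
qed

section \<open>The time translation operator\<close>

lemma layer_insert: "layer t (insert (u, i) S) = (if t = u then insert i (layer t S) else layer t S)"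
  by (auto simp: layer_def)

lemma card_below_insert:
  assumes "finite S" "(u, i) \<notin> S"
  shows "card_below t (insert (u, i) S) = (if u < t then Suc (card_below t S) else card_below t S)"
proof -
  have "{x\<in>insert (u, i) S. fst x < t}
      = (if u < t then insert (u, i) {x\<in>S. fst x < t} else {x\<in>S. fst x < t})"
    by auto
  with assms show ?thesis by (simp add: card_below_def)
qed

definition next_mode :: "nat \<Rightarrow> nat \<times> 'a \<Rightarrow> nat \<times> 'a" where
  "next_mode N = (\<lambda>(t, i). (Suc t mod N, i))"

lemma bij_betw_next_mode:
  assumes "finite A"
  shows "bij_betw (next_mode N) ({0..<N} \<times> A) ({0..<N} \<times> A)"
proof -
  have "inj_on (next_mode N) ({0..<N} \<times> A)"
    by (auto simp: inj_on_def next_mode_def mod_Suc split: if_splits)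
  moreover have "next_mode N ` ({0..<N} \<times> A) \<subseteq> {0..<N} \<times> A"
    by (auto simp: next_mode_def)
  ultimately show ?thesis
    using assms by (simp add: bij_betw_def endo_inj_surj)
qed

lemma next_mode_image_subset: "S \<subseteq> {0..<N} \<times> A \<Longrightarrow> next_mode N ` S \<subseteq> {0..<N} \<times> A"
  by (fastforce simp: next_mode_def)

lemma layer_next_mode:
  assumes "S \<subseteq> {0..<N} \<times> A" "t < N"
  shows "layer (Suc t mod N) (next_mode N ` S) = layer t S"
proof -
  have "u = t" if "(u, i) \<in> S" "Suc u mod N = Suc t mod N" for u i
    using that assms by (force simp: mod_Suc split: if_splits)
  then show ?thesis
    by (force simp: layer_def next_mode_def)
qed

lemma card_below_next_mode:
  assumes "finite S" "S \<subseteq> {0..<N} \<times> A" "Suc t < N"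
  shows "card_below (Suc t) (next_mode N ` S) = card (layer (N - 1) S) + card_below t S"
proof -
  let ?T = "{x\<in>S. fst x < t} \<union> Pair (N - 1) ` layer (N - 1) S"
  have "{x \<in> next_mode N ` S. fst x < Suc t} = next_mode N ` ?T"
    using assms(2,3) by (force simp: next_mode_def layer_def mod_Suc split: if_splits)
  moreover have "inj_on (next_mode N) S"
    using assms(2) by (auto simp: inj_on_def next_mode_def mod_Suc subset_iff split: if_splits)
  then have "inj_on (next_mode N) ?T"
    by (rule inj_on_subset) (auto simp: layer_def)
  moreover have "{x\<in>S. fst x < t} \<inter> Pair (N - 1) ` layer (N - 1) S = {}"
    using assms(3) by auto
  ultimately show ?thesis
    using assms(1) finite_layer[OF assms(1), of "N - 1"]
    by (simp add: card_below_def card_image card_Un_disjoint inj_on_def)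
qed

text \<open>Each particle of the last slice contributes a sign \<open>-1\<close> on wrapping around to slice \<open>0\<close> and is moved
  past all particles of the other slices.\<close>

definition shift_sign :: "nat \<Rightarrow> (nat \<times> 'a) set \<Rightarrow> complex" where
  "shift_sign N S = (-1) ^ (card (layer (N - 1) S) * Suc (card_below (N - 1) S))"

definition time_shift :: "nat \<Rightarrow> 'a set \<Rightarrow> (nat \<times> 'a) op" where
  "time_shift N A = (\<lambda>S T. if T \<subseteq> {0..<N} \<times> A \<and> S = next_mode N ` T then shift_sign N T else 0)"

lemma is_op_time_shift [simp]: "is_op ({0..<N} \<times> A) (time_shift N A)"
  unfolding is_op_def time_shift_def by (simp add: next_mode_image_subset)

lemma op_mult_time_shift_right:
  assumes "finite A"
  shows "(X \<odot>\<^bsub>{0..<N} \<times> A\<^esub> time_shift N A) S U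
    = (if U \<subseteq> {0..<N} \<times> A then shift_sign N U * X S (next_mode N ` U) else 0)"
proof (cases "U \<subseteq> {0..<N} \<times> A")
  case True
  then show ?thesis
    using assms next_mode_image_subset[OF True]
    by (subst op_mult_single_column[of _ "next_mode N ` U"]) (auto simp: time_shift_def)
next
  case False
  then show ?thesis
    by (subst op_mult_zero_column) (auto simp: time_shift_def)
qed

definition wrap_sign :: "nat \<Rightarrow> nat \<times> 'a \<Rightarrow> complex" where
  "wrap_sign N x = (if Suc (fst x) = N then -1 else 1)"

lemma shift_sign_insert:
  assumes "finite S" "S \<subseteq> {0..<N} \<times> A" "x \<in> {0..<N} \<times> A" "x \<notin> S"
  shows "jw_sign x S * shift_sign N (insert x S)
    = wrap_sign N x * jw_sign (next_mode N x) (next_mode N ` S) * shift_sign N S"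
proof -
  obtain t i where x: "x = (t, i)" "t < N" "i \<notin> layer t S"
    using assms(3,4) by (auto simp: layer_def)
  let ?m = "card (layer (N - 1) S)" and ?r = "card_below (N - 1) S"
  have fin: "finite (layer (N - 1) S)" "finite (next_mode N ` S)"
    using assms(1) by (simp_all add: finite_layer)
  have jw_sign_next: "jw_sign (next_mode N x) (next_mode N ` S)
      = (-1) ^ card_below (Suc t mod N) (next_mode N ` S) * jw_sign i (layer t S)"
    unfolding layer_next_mode[OF assms(2) x(2), symmetric] jw_sign_Pair[OF fin(2), symmetric]
    by (simp add: x(1) next_mode_def)
  show ?thesis
  proof (cases "Suc t = N")
    case True
    then have "t = N - 1" by simp
    then have "jw_sign x S * shift_sign N (insert x S)
        = (-1) ^ (?r + Suc ?m * Suc ?r) * jw_sign i (layer t S)"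
      using x fin(1) assms(1,4)
      by (simp add: jw_sign_Pair shift_sign_def layer_insert card_below_insert power_add)
    moreover have "(-1) ^ (?r + Suc ?m * Suc ?r) = ((-1) ^ Suc (?m * Suc ?r) :: complex)"
      by (rule minus_one_power_cong) auto
    moreover have "card_below (Suc t mod N) (next_mode N ` S) = 0"
      using True by (simp add: card_below_def)
    ultimately show ?thesis
      unfolding jw_sign_next using True by (simp add: x(1) wrap_sign_def shift_sign_def)
  next
    case False
    then have "jw_sign x S * shift_sign N (insert x S)
        = (-1) ^ (card_below t S + ?m * Suc (Suc ?r)) * jw_sign i (layer t S)"
      using x assms(1,4)
      by (simp add: jw_sign_Pair shift_sign_def layer_insert card_below_insert power_add)
    moreover have "card_below (Suc t mod N) (next_mode N ` S) = ?m + card_below t S"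
      using False x(2) card_below_next_mode[OF assms(1,2), of t] by simp
    ultimately show ?thesis
      unfolding jw_sign_next using False by (simp add: x(1) wrap_sign_def shift_sign_def power_add)
  qed
qed

lemma time_shift_cre:
  assumes "finite A" "x \<in> {0..<N} \<times> A"
  shows "time_shift N A \<odot>\<^bsub>{0..<N} \<times> A\<^esub> cre ({0..<N} \<times> A) x
    = wrap_sign N x \<cdot> (cre ({0..<N} \<times> A) (next_mode N x) \<odot>\<^bsub>{0..<N} \<times> A\<^esub> time_shift N A)"
proof (intro ext)
  fix S U
  let ?M = "{0..<N} \<times> A"
  have M: "finite ?M" using assms(1) by simp
  have entries: "(time_shift N A \<odot>\<^bsub>?M\<^esub> cre ?M x) S U
      = (if U \<subseteq> ?M \<and> x \<notin> U then jw_sign x U * time_shift N A S (insert x U) else 0)"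
    "(cre ?M (next_mode N x) \<odot>\<^bsub>?M\<^esub> time_shift N A) S U
      = (if U \<subseteq> ?M then shift_sign N U * cre ?M (next_mode N x) S (next_mode N ` U) else 0)"
    using assms by (simp_all add: op_mult_cre_right op_mult_time_shift_right)
  have "next_mode N x \<in> ?M"
    using next_mode_image_subset[of "{x}" N A] assms(2) by simp
  moreover have "next_mode N x \<in> next_mode N ` U \<longleftrightarrow> x \<in> U" if "U \<subseteq> ?M"
    using bij_betw_imp_inj_on[OF bij_betw_next_mode[OF assms(1)]] assms(2) that
    by (rule inj_on_image_mem_iff)
  ultimately show "(time_shift N A \<odot>\<^bsub>?M\<^esub> cre ?M x) S U
    = (wrap_sign N x \<cdot> (cre ?M (next_mode N x) \<odot>\<^bsub>?M\<^esub> time_shift N A)) S U"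
    using shift_sign_insert[OF finite_subset[OF _ M] _ assms(2), of U] assms(2)
      next_mode_image_subset[of U N A] unfolding op_scale_def entries
    by (simp add: time_shift_def cre_apply)
qed

lemma time_shift_cre_lin:
  assumes "finite A" and h: "\<And>x. x \<in> {0..<N} \<times> A \<Longrightarrow> h (next_mode N x) = wrap_sign N x * g x"
  shows "time_shift N A \<odot>\<^bsub>{0..<N} \<times> A\<^esub> cre_lin ({0..<N} \<times> A) g
    = cre_lin ({0..<N} \<times> A) h \<odot>\<^bsub>{0..<N} \<times> A\<^esub> time_shift N A"
proof (intro ext)
  fix S U
  let ?M = "{0..<N} \<times> A"
  let ?W = "time_shift N A"
  have "(?W \<odot>\<^bsub>?M\<^esub> cre_lin ?M g) S U = (\<Sum>x\<in>?M. g x * (?W \<odot>\<^bsub>?M\<^esub> cre ?M x) S U)"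
    unfolding cre_lin_def op_mult_linear by (simp add: op_sum_def op_scale_def)
  also have "\<dots> = (\<Sum>x\<in>?M. h (next_mode N x) * (cre ?M (next_mode N x) \<odot>\<^bsub>?M\<^esub> ?W) S U)"
    using assms by (intro sum.cong refl) (simp add: time_shift_cre op_scale_def)
  also have "\<dots> = (\<Sum>y\<in>?M. h y * (cre ?M y \<odot>\<^bsub>?M\<^esub> ?W) S U)"
    by (rule sum.reindex_bij_betw[OF bij_betw_next_mode[OF assms(1)]])
  also have "\<dots> = (cre_lin ?M h \<odot>\<^bsub>?M\<^esub> ?W) S U"
    unfolding cre_lin_def op_mult_linear by (simp add: op_sum_def op_scale_def)
  finally show "(?W \<odot>\<^bsub>?M\<^esub> cre_lin ?M g) S U = (cre_lin ?M h \<odot>\<^bsub>?M\<^esub> ?W) S U" .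
qed

lemma sum_cis_orthogonal:
  assumes "m < N" "n < N"
  shows "(\<Sum>t<N. cis (2 * pi * (real m - real n) * real t / real N)) = (if m = n then of_nat N else 0)"
proof (cases "m = n")
  case False
  define z where "z = cis (2 * pi * real m / real N) / cis (2 * pi * real n / real N)"
  have pow: "z ^ t = cis (2 * pi * (real m - real n) * real t / real N)" for t
    unfolding z_def cis_divide DeMoivre
    by (rule arg_cong[where f = cis]) (use assms in \<open>simp add: field_simps\<close>)
  have "inj_on (\<lambda>k. cis (2 * pi * real k / real N)) {..<N}"
    using bij_betw_roots_unity[of N] assms by (auto simp: bij_betw_def)
  then have "z \<noteq> 1"
    using False assms by (auto simp: z_def inj_on_def)
  moreover have "z ^ N = cis (2 * pi * (real m - real n))"
    using assms by (simp add: pow)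
  then have "z ^ N = 1"
    by (simp only: cis_multiple_2pi Ints_diff Ints_of_nat)
  ultimately have "(\<Sum>t<N. z ^ t) = 0"
    by (simp add: geometric_sum)
  with False show ?thesis by (simp add: pow)
qed simp

definition fourier_mode :: "nat \<Rightarrow> nat \<times> 'a \<Rightarrow> nat \<times> 'a \<Rightarrow> complex" where
  "fourier_mode N = (\<lambda>(n, j) (t, i).
     if i = j then of_real (1 / sqrt (real N)) * cis (pi * (2 * real n + 1) * real t / real N) else 0)"

lemma fourier_mode_mult_cnj:
  "fourier_mode N (m, i) (t, k) * cnj (fourier_mode N (n, j) (u, l))
    = (if k = i then if l = j then
         cis (pi * ((2 * real m + 1) * real t - (2 * real n + 1) * real u) / real N) / of_nat N
       else 0 else 0)"
proof -
  have "complex_of_real (1 / sqrt (real N)) * of_real (1 / sqrt (real N)) = 1 / of_nat N"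
    by (simp flip: of_real_mult)
  moreover have "cis (pi * (2 * real m + 1) * real t / real N)
        * cis (- (pi * (2 * real n + 1) * real u / real N))
      = cis (pi * ((2 * real m + 1) * real t - (2 * real n + 1) * real u) / real N)"
    unfolding cis_mult
    by (rule arg_cong[where f = cis]) (simp add: algebra_simps add_divide_distrib diff_divide_distrib)
  ultimately show ?thesis
    by (simp add: fourier_mode_def cis_cnj)
qed

lemma fourier_mode_orthonormal:
  assumes "finite A" "k \<in> {0..<N} \<times> A" "l \<in> {0..<N} \<times> A"
  shows "(\<Sum>x\<in>{0..<N} \<times> A. fourier_mode N k x * cnj (fourier_mode N l x)) = (if k = l then 1 else 0)"
proof -
  obtain m i n j where kl: "k = (m, i)" "l = (n, j)" "m < N" "n < N" "i \<in> A" "j \<in> A"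
    using assms(2,3) by auto
  have angle: "pi * ((2 * real m + 1) * real t - (2 * real n + 1) * real t) / real N
      = 2 * pi * (real m - real n) * real t / real N" for t
    by (simp add: algebra_simps)
  have "(\<Sum>x\<in>{0..<N} \<times> A. fourier_mode N k x * cnj (fourier_mode N l x))
      = (\<Sum>t<N. if i = j then cis (2 * pi * (real m - real n) * real t / real N) / of_nat N else 0)"
    using assms(1) kl(5,6) unfolding kl(1,2) sum.cartesian_product' fourier_mode_mult_cnj angle
    by (intro sum.cong) (auto simp: sum.delta')
  also have "\<dots> = (if k = l then 1 else 0)"
    using sum_cis_orthogonal[OF kl(3,4)] kl by (cases "i = j") (simp_all flip: sum_divide_distrib)
  finally show ?thesis .
qed

lemma fourier_mode_complete:
  assumes "finite A" "x \<in> {0..<N} \<times> A" "y \<in> {0..<N} \<times> A"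
  shows "(\<Sum>k\<in>{0..<N} \<times> A. fourier_mode N k x * cnj (fourier_mode N k y)) = (if x = y then 1 else 0)"
proof -
  obtain t i u j where xy: "x = (t, i)" "y = (u, j)" "t < N" "u < N" "i \<in> A" "j \<in> A"
    using assms(2,3) by auto
  have phase: "cis (pi * ((2 * real n + 1) * real t - (2 * real n + 1) * real u) / real N)
      = cis (pi * (real t - real u) / real N) * cis (2 * pi * (real t - real u) * real n / real N)" for n
    unfolding cis_mult
    by (rule arg_cong[where f = cis]) (simp add: algebra_simps add_divide_distrib diff_divide_distrib)
  have "(\<Sum>k\<in>{0..<N} \<times> A. fourier_mode N k x * cnj (fourier_mode N k y))
      = (\<Sum>n<N. if i = j then cis (pi * (real t - real u) / real N)
          * cis (2 * pi * (real t - real u) * real n / real N) / of_nat N else 0)"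
    using assms(1) xy(5,6) unfolding xy(1,2) sum.cartesian_product' fourier_mode_mult_cnj phase
    by (intro sum.cong) (auto simp: sum.delta)
  also have "\<dots> = (if x = y then 1 else 0)"
    using sum_cis_orthogonal[OF xy(3,4)] xy
    by (cases "i = j") (simp_all flip: sum_divide_distrib sum_distrib_left)
  finally show ?thesis .
qed

lemma fourier_mode_next:
  assumes "x \<in> {0..<N} \<times> A"
  shows "cis (pi * (2 * real n + 1) / real N) * cnj (fourier_mode N (n, j) (next_mode N x))
    = wrap_sign N x * cnj (fourier_mode N (n, j) x)"
proof -
  obtain t i where x: "x = (t, i)" "t < N" using assms by auto
  let ?\<theta> = "pi * (2 * real n + 1)"
  have "cis (?\<theta> / real N) * cis (- (?\<theta> * real (Suc t mod N) / real N))
      = wrap_sign N x * cis (- (?\<theta> * real t / real N))"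
  proof (cases "Suc t = N")
    case True
    have "cis (- (?\<theta> * real t / real N)) = cis (?\<theta> / real N - ?\<theta>)"
      using True[symmetric] by (intro arg_cong[where f = cis]) (simp add: field_simps)
    also have "\<dots> = cis (?\<theta> / real N) * cis (2 * pi * real_of_int (- int n) - pi)"
      unfolding cis_mult by (rule arg_cong[where f = cis]) (simp add: algebra_simps)
    also have "\<dots> = - cis (?\<theta> / real N)"
      by (simp add: cis_multiple_2pi del: of_int_minus flip: minus_cis')
    finally show ?thesis using True by (simp add: x wrap_sign_def)
  next
    case False
    then have "?\<theta> / real N + - (?\<theta> * real (Suc t mod N) / real N) = - (?\<theta> * real t / real N)"
      using x(2) by (simp add: field_simps)
    with False show ?thesis by (simp add: cis_mult x wrap_sign_def)
  qed
  then show ?thesis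
    by (simp add: x next_mode_def fourier_mode_def cis_cnj)
qed

definition fourier_cre :: "nat \<Rightarrow> 'a::linorder set \<Rightarrow> nat \<times> 'a \<Rightarrow> (nat \<times> 'a) op" where
  "fourier_cre N A k = cre_lin ({0..<N} \<times> A) (\<lambda>x. cnj (fourier_mode N k x))"

lemma is_op_fourier_cre [simp]: "is_op ({0..<N} \<times> A) (fourier_cre N A k)"
  by (simp add: fourier_cre_def)

lemma cre_eq_sum_fourier_cre:
  assumes "finite A" "x \<in> {0..<N} \<times> A"
  shows "cre ({0..<N} \<times> A) x = op_sum (\<lambda>k. fourier_mode N k x \<cdot> fourier_cre N A k) ({0..<N} \<times> A)"
proof -
  have "cre ({0..<N} \<times> A) x = cre_lin ({0..<N} \<times> A) (\<lambda>y. if y = x then 1 else 0)"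
    using assms by (simp add: cre_eq_cre_lin)
  also have "\<dots> = cre_lin ({0..<N} \<times> A)
      (\<lambda>y. \<Sum>k\<in>{0..<N} \<times> A. fourier_mode N k x * cnj (fourier_mode N k y))"
    unfolding cre_lin_def using fourier_mode_complete[OF assms] by (intro op_sum_cong) auto
  finally show ?thesis
    by (simp add: fourier_cre_def op_sum_cre_lin)
qed

lemma time_shift_fourier_cre:
  assumes "finite A"
  shows "time_shift N A \<odot>\<^bsub>{0..<N} \<times> A\<^esub> fourier_cre N A (n, j)
    = cis (pi * (2 * real n + 1) / real N) \<cdot> (fourier_cre N A (n, j) \<odot>\<^bsub>{0..<N} \<times> A\<^esub> time_shift N A)"
proof -
  let ?z = "cis (pi * (2 * real n + 1) / real N)"
  have "time_shift N A \<odot>\<^bsub>{0..<N} \<times> A\<^esub> fourier_cre N A (n, j)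
      = cre_lin ({0..<N} \<times> A) (\<lambda>x. ?z * cnj (fourier_mode N (n, j) x)) \<odot>\<^bsub>{0..<N} \<times> A\<^esub> time_shift N A"
    unfolding fourier_cre_def using assms fourier_mode_next by (rule time_shift_cre_lin)
  also have "cre_lin ({0..<N} \<times> A) (\<lambda>x. ?z * cnj (fourier_mode N (n, j) x))
      = ?z \<cdot> fourier_cre N A (n, j)"
    by (simp add: fourier_cre_def cre_lin_def op_scale_sum_right op_scale_scale)
  finally show ?thesis
    by (simp add: op_mult_linear)
qed

lemma exp_omega:
  assumes "\<epsilon> > 0"
  shows "exp (\<i> * of_real (omega \<epsilon> N n * \<epsilon> * s)) = cis (pi * (2 * real n + 1) * s / real N)"
proof -
  have "omega \<epsilon> N n * \<epsilon> * s = pi * (2 * real n + 1) * s / real N"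
    using assms by (simp add: omega_def mult_ac)
  then show ?thesis by (simp add: cis_conv_exp)
qed

lemma ahat_eq_ann_lin:
  assumes "\<epsilon> > 0" "j \<in> modes_h L"
  shows "ahat \<epsilon> N L n j = ann_lin (modes_H N L) (fourier_mode N (n, j))"
proof (intro ext)
  fix S T
  have "ann_lin (modes_H N L) (fourier_mode N (n, j)) S T
      = (\<Sum>t = 0..<N. \<Sum>i\<in>modes_h L.
          if i = j then fourier_mode N (n, j) (t, j) * ann (modes_H N L) (t, j) S T else 0)"
    unfolding ann_lin_def op_sum_def op_scale_def unfolding modes_H_eq sum.cartesian_product'
    by (intro sum.cong) (auto simp: fourier_mode_def)
  then show "ahat \<epsilon> N L n j S T = ann_lin (modes_H N L) (fourier_mode N (n, j)) S T"
    unfolding ahat_def exp_omega[OF assms(1)] using assms(2)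
    by (simp add: op_scale_def op_sum_def fourier_mode_def sum_distrib_left mult.assoc)
qed

lemma calP_eq_quadratic:
  assumes "\<epsilon> > 0"
  shows "calP \<epsilon> N L = op_sum (\<lambda>k. of_real (omega \<epsilon> N (fst k)) \<cdot>
    (fourier_cre N (modes_h L) k \<odot>\<^bsub>modes_H N L\<^esub> ann_lin (modes_H N L) (fourier_mode N k))) (modes_H N L)"
  unfolding calP_def modes_h_def[symmetric] modes_H_eq[symmetric]
  by (intro op_sum_cong)
    (auto simp: ahat_eq_ann_lin[OF assms] op_adj_ann_lin fourier_cre_def modes_H_eq)

lemma calP_fourier_cre_commutator:
  assumes "\<epsilon> > 0" "k \<in> modes_H N L"
  shows "calP \<epsilon> N L \<odot>\<^bsub>modes_H N L\<^esub> fourier_cre N (modes_h L) k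
    = (fourier_cre N (modes_h L) k \<odot>\<^bsub>modes_H N L\<^esub> calP \<epsilon> N L)
      \<oplus> of_real (omega \<epsilon> N (fst k)) \<cdot> fourier_cre N (modes_h L) k"
  unfolding calP_eq_quadratic[OF assms(1)] fourier_cre_def modes_H_eq
  by (rule diagonal_quadratic_commutator)
    (use assms(2) in \<open>simp_all add: modes_H_eq fourier_mode_orthonormal\<close>)

lemma is_op_calP [simp]: "is_op (modes_H N L) (calP \<epsilon> N L)"
  unfolding calP_def ahat_def by (intro is_op_sum) auto

lemma calP_vacuum: "calP \<epsilon> N L S {} = 0"
proof -
  have "ahat \<epsilon> N L n j T {} = 0" for n j T
    by (simp add: ahat_def op_scale_def op_sum_def ann_apply)
  then show ?thesis
    by (simp add: calP_def op_scale_def op_sum_def op_mult_def split_def)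
qed

lemma op_exp_calP:
  assumes "\<epsilon> > 0"
  shows "op_exp (modes_H N L) ((\<i> * of_real \<epsilon>) \<cdot> calP \<epsilon> N L) = time_shift N (modes_h L)"
proof (rule op_exp_eqI_ladder[where K = "modes_H N L" and C = "fourier_cre N (modes_h L)"
      and l = "\<lambda>k. \<i> * of_real (omega \<epsilon> N (fst k) * \<epsilon> * 1)" and c = "\<lambda>x k. fourier_mode N k x"])
  let ?M = "modes_H N L" and ?C = "fourier_cre N (modes_h L)"
  let ?l = "\<lambda>k. \<i> * complex_of_real (omega \<epsilon> N (fst k) * \<epsilon> * 1)"
  show "((\<i> * of_real \<epsilon>) \<cdot> calP \<epsilon> N L) S {} = 0" for S
    by (simp add: op_scale_def calP_vacuum)
  show "time_shift N (modes_h L) S {} = (if S = {} then 1 else 0)" for S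
    by (auto simp: time_shift_def shift_sign_def layer_def)
  show "((\<i> * of_real \<epsilon>) \<cdot> calP \<epsilon> N L) \<odot>\<^bsub>?M\<^esub> ?C k
      = (?C k \<odot>\<^bsub>?M\<^esub> (\<i> * of_real \<epsilon>) \<cdot> calP \<epsilon> N L) \<oplus> ?l k \<cdot> ?C k" if "k \<in> ?M" for k
    by (simp add: op_mult_linear calP_fourier_cre_commutator[OF assms that] op_scale_add_right
        op_scale_scale mult_ac)
  show "time_shift N (modes_h L) \<odot>\<^bsub>?M\<^esub> ?C k = exp (?l k) \<cdot> (?C k \<odot>\<^bsub>?M\<^esub> time_shift N (modes_h L))" for k
    unfolding exp_omega[OF assms] modes_H_eq
    using time_shift_fourier_cre[of "modes_h L" N "fst k" "snd k"] by simp
  show "cre ?M x = op_sum (\<lambda>k. fourier_mode N k x \<cdot> ?C k) ?M" if "x \<in> ?M" for x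
    using that cre_eq_sum_fourier_cre[of "modes_h L" x N] by (simp add: modes_H_eq)
qed (simp_all add: modes_H_eq is_op_calP[unfolded modes_H_eq])

section \<open>The trace of a time-ordered product\<close>

lemma ordered_place_apply:
  assumes "finite A" "n \<le> N" "S \<subseteq> {0..<N} \<times> A" "U \<subseteq> {0..<N} \<times> A"
  shows "op_list_prod ({0..<N} \<times> A) (map (\<lambda>t. place {0..<N} A t (X t)) (rev [0..<n])) S U
    = (if \<forall>t\<ge>n. layer t S = layer t U
       then \<Prod>t<n. layer_sign t S (layer t U) * X t (layer t S) (layer t U)
       else 0)"
  using assms(2,3)
proof (induction n arbitrary: S)
  case 0
  then show ?case using assms(4) layers_eqI[of S U] by (auto simp: op_one_def)
next
  case (Suc n)
  let ?M = "{0..<N} \<times> A"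
  let ?Z = "op_list_prod ?M (map (\<lambda>t. place {0..<N} A t (X t)) (rev [0..<n]))"
  let ?S = "set_layer n (layer n U) S"
  let ?f = "\<lambda>S t. layer_sign t S (layer t U) * X t (layer t S) (layer t U)"
  have Z: "?Z T U = (if \<forall>t\<ge>n. layer t T = layer t U then \<Prod>t<n. ?f T t else 0)" if "T \<subseteq> ?M" for T
    using Suc.prems(1) that by (intro Suc.IH) simp_all
  then have "layer n T = layer n U" if "T \<subseteq> ?M" "?Z T U \<noteq> 0" for T
    using that by (auto split: if_splits)
  then have local: "(place {0..<N} A n (X n) \<odot>\<^bsub>?M\<^esub> ?Z) S U = ?f S n * ?Z ?S U"
    using Suc.prems assms by (intro place_mult_local) auto
  have "?S \<subseteq> ?M"
    using Suc.prems assms by (intro set_layer_subset layer_subset) auto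
  moreover have "card_below t ?S = card_below t S" if "t < n" for t
    using that by (intro card_below_cong) auto
  then have "(\<Prod>t<n. ?f ?S t) = (\<Prod>t<n. ?f S t)"
    by (intro prod.cong) (auto simp: layer_sign_def)
  moreover have "(\<forall>t\<ge>n. layer t ?S = layer t U) \<longleftrightarrow> (\<forall>t\<ge>Suc n. layer t S = layer t U)"
    by (auto simp: le_eq_less_or_eq[of n] Suc_le_eq)
  ultimately have "?Z ?S U = (if \<forall>t\<ge>Suc n. layer t S = layer t U then \<Prod>t<n. ?f S t else 0)"
    by (simp only: Z)
  with local show ?case by (auto simp: mult.commute)
qed

lemma trace_parity_time_shift:
  fixes N :: nat
  assumes "finite A" "is_op ({0..<N} \<times> A) Z"
  defines "M \<equiv> {0..<N} \<times> A"
  shows "op_trace M (parity_op M \<odot>\<^bsub>M\<^esub> time_shift N A \<odot>\<^bsub>M\<^esub> Z)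
    = (\<Sum>S\<in>Pow M. (-1) ^ card S * shift_sign N S * Z S (next_mode N ` S))"
proof -
  have M: "finite M" using assms by simp
  have "card (next_mode N ` S) = card S" if "S \<subseteq> M" for S
    using that bij_betw_imp_inj_on[OF bij_betw_next_mode[OF assms(1)]]
    unfolding M_def by (intro card_image) (rule inj_on_subset)
  then have entry: "((Z \<odot>\<^bsub>M\<^esub> parity_op M) \<odot>\<^bsub>M\<^esub> time_shift N A) S S
      = (-1) ^ card S * shift_sign N S * Z S (next_mode N ` S)" if "S \<subseteq> M" for S
    using that assms(1,2) unfolding parity_op_eq_diag[OF M]
    by (simp add: M_def op_mult_time_shift_right op_mult_diag_right)
  have "op_trace M (parity_op M \<odot>\<^bsub>M\<^esub> time_shift N A \<odot>\<^bsub>M\<^esub> Z)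
      = op_trace M ((Z \<odot>\<^bsub>M\<^esub> parity_op M) \<odot>\<^bsub>M\<^esub> time_shift N A)"
    by (subst op_mult_assoc[symmetric], subst op_trace_mult_commute) (simp add: op_mult_assoc)
  then show ?thesis
    using entry by (simp add: op_trace_def)
qed

lemma card_below_Suc:
  assumes "finite S"
  shows "card_below (Suc t) S = card_below t S + card (layer t S)"
proof -
  have "{x\<in>off_layer t S. fst x < Suc t} = {x\<in>S. fst x < t}"
    by (auto simp: off_layer_def)
  then show ?thesis
    using card_below_eq_off_plus_layer[OF assms, of t "Suc t"] by (simp add: card_below_def)
qed

lemma even_closed_path_exponent:
  fixes b c d :: "nat \<Rightarrow> nat"
  assumes "b 0 = 0" "\<And>t. b (Suc t) = b t + c t" "\<And>t. t < n \<Longrightarrow> d (Suc t) = c t"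
  shows "even ((\<Sum>t<Suc n. (c t + d t) * b t) + c n * b n + b n)"
  using assms(3)
proof (induction n)
  case 0
  then show ?case using assms(1) by simp
next
  case (Suc n)
  then have "even ((\<Sum>t<Suc n. (c t + d t) * b t) + c n * b n + b n)" by simp
  then show ?case
    using Suc.prems[of n] assms(2)[of n] by (simp add: sum.lessThan_Suc[of _ "Suc n"]) auto
qed

lemma closed_path_sign:
  assumes "finite A" "S \<subseteq> {0..<N} \<times> A" "N > 0"
  shows "(-1) ^ card S * shift_sign N S * (\<Prod>t<N. layer_sign t S (layer t (next_mode N ` S))) = 1"
proof -
  obtain n where N: "N = Suc n" using assms(3) by (cases N) auto
  let ?b = "\<lambda>t. card_below t S" and ?c = "\<lambda>t. card (layer t S)"
    and ?d = "\<lambda>t. card (layer t (next_mode N ` S))"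
  have fin: "finite S" using assms(1,2) by (meson finite_SigmaI finite_atLeastLessThan finite_subset)
  have "layer (Suc t) (next_mode N ` S) = layer t S" if "t < n" for t
    using layer_next_mode[OF assms(2), of t] that N by simp
  then have "even ((\<Sum>t<N. (?c t + ?d t) * ?b t) + ?c n * ?b n + ?b n)"
    unfolding N using fin
    by (intro even_closed_path_exponent) (auto simp: card_below_Suc, simp add: card_below_def)
  moreover have "{x\<in>S. fst x < N} = S"
    using assms(2) by auto
  then have "card S = ?b n + ?c n"
    using card_below_Suc[OF fin, of n] N by (simp add: card_below_def)
  ultimately have "even (card S + ?c n * Suc (?b n) + (\<Sum>t<N. (?c t + ?d t) * ?b t) + 0)"
    by auto
  then have "(-1) ^ (card S + ?c n * Suc (?b n) + (\<Sum>t<N. (?c t + ?d t) * ?b t)) = ((-1) ^ 0 :: complex)"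
    by (rule minus_one_power_cong)
  then show ?thesis
    by (simp add: shift_sign_def layer_sign_def N power_add power_sum)
qed

definition path_weight :: "(nat \<Rightarrow> 'a op) \<Rightarrow> nat \<Rightarrow> 'a set \<Rightarrow> (nat \<times> 'a) set \<Rightarrow> complex" where
  "path_weight X n Q S = X 0 (layer 0 S) Q * (\<Prod>t<n. X (Suc t) (layer (Suc t) S) (layer t S))"

lemma path_weight_Suc:
  "path_weight X (Suc n) Q (set_layer (Suc n) R S) = X (Suc n) R (layer n S) * path_weight X n Q S"
proof -
  have "(\<Prod>t<n. X (Suc t) (layer (Suc t) (set_layer (Suc n) R S)) (layer t (set_layer (Suc n) R S)))
      = (\<Prod>t<n. X (Suc t) (layer (Suc t) S) (layer t S))"
    by (intro prod.cong) auto
  then show ?thesis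
    by (simp add: path_weight_def mult_ac)
qed

lemma trace_ordered_place_eq_sum_paths:
  fixes n :: nat
  assumes "finite A"
  defines "M \<equiv> {0..<Suc n} \<times> A"
  shows "op_trace M (parity_op M \<odot>\<^bsub>M\<^esub> time_shift (Suc n) A
      \<odot>\<^bsub>M\<^esub> op_list_prod M (map (\<lambda>t. place {0..<Suc n} A t (X t)) (rev [0..<Suc n])))
    = (\<Sum>S\<in>Pow M. path_weight X n (layer n S) S)"
proof -
  let ?N = "Suc n"
  let ?Z = "op_list_prod M (map (\<lambda>t. place {0..<?N} A t (X t)) (rev [0..<?N]))"
  have "(-1) ^ card S * shift_sign ?N S * ?Z S (next_mode ?N ` S) = path_weight X n (layer n S) S"
    if "S \<subseteq> M" for S
  proof -
    let ?U = "next_mode ?N ` S"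
    have S: "S \<subseteq> {0..<?N} \<times> A" using that by (simp add: M_def)
    have U: "?U \<subseteq> {0..<?N} \<times> A" using S by (rule next_mode_image_subset)
    have "layer t S = {}" "layer t ?U = {}" if "t \<ge> ?N" for t
      using that S U by (auto simp: layer_def)
    then have factors: "?Z S ?U
        = (\<Prod>t<?N. layer_sign t S (layer t ?U)) * (\<Prod>t<?N. X t (layer t S) (layer t ?U))"
      unfolding M_def ordered_place_apply[OF assms(1) order_refl S U]
      by (simp only: prod.distrib if_True) simp
    have first: "layer 0 ?U = layer n S"
      using layer_next_mode[OF S, of n] by simp
    have "layer (Suc t) ?U = layer t S" if "t < n" for t
      using layer_next_mode[OF S, of t] that by simp
    then have "(\<Prod>t<?N. X t (layer t S) (layer t ?U)) = path_weight X n (layer n S) S"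
      unfolding prod.lessThan_Suc_shift first by (simp add: path_weight_def)
    then show ?thesis
      unfolding factors using closed_path_sign[OF assms(1) S] by (simp add: mult.assoc[symmetric])
  qed
  then show ?thesis
    using assms(1) unfolding M_def by (subst trace_parity_time_shift) auto
qed

lemma sum_Pow_Suc_layers:
  "(\<Sum>S\<in>Pow ({0..<Suc n} \<times> A). f S) = (\<Sum>R\<in>Pow A. \<Sum>S\<in>Pow ({0..<n} \<times> A). f (set_layer n R S))"
proof -
  have off_layer_idem: "off_layer n S = S" if "S \<subseteq> {0..<n} \<times> A" for S
    using that by (auto simp: off_layer_def)
  have "(\<Sum>S\<in>Pow ({0..<Suc n} \<times> A). f S) = (\<Sum>(R, S)\<in>Pow A \<times> Pow ({0..<n} \<times> A). f (set_layer n R S))"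
  proof (rule sum.reindex_bij_witness[where i = "\<lambda>(R, S). set_layer n R S"
        and j = "\<lambda>S. (layer n S, off_layer n S)"])
    fix S assume S: "S \<in> Pow ({0..<Suc n} \<times> A)"
    have "set_layer n (layer n S) (off_layer n S) = S"
      by (auto simp: set_layer_def layer_def off_layer_def)
    then show "(case (layer n S, off_layer n S) of (R, S) \<Rightarrow> set_layer n R S) = S"
      "(case (layer n S, off_layer n S) of (R, S) \<Rightarrow> f (set_layer n R S)) = f S"
      by simp_all
    show "(layer n S, off_layer n S) \<in> Pow A \<times> Pow ({0..<n} \<times> A)"
      using S by (fastforce simp: layer_def off_layer_def)
  next
    fix p assume "p \<in> Pow A \<times> Pow ({0..<n} \<times> A)"
    then obtain R S where p: "p = (R, S)" "R \<subseteq> A" "S \<subseteq> {0..<n} \<times> A" by auto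
    then show "(layer n (case p of (R, S) \<Rightarrow> set_layer n R S),
        off_layer n (case p of (R, S) \<Rightarrow> set_layer n R S)) = p"
      by (simp add: off_layer_idem)
    have "S \<subseteq> {0..<Suc n} \<times> A" using p(3) by auto
    then show "(case p of (R, S) \<Rightarrow> set_layer n R S) \<in> Pow ({0..<Suc n} \<times> A)"
      using p(1,2) set_layer_subset[of n "{0..<Suc n}" S A R] by simp
  qed
  then show ?thesis by (simp add: sum.cartesian_product)
qed

lemma ordered_prod_eq_sum_paths:
  assumes "finite A" "is_op A (X 0)"
  shows "op_list_prod A (map X (rev [0..<Suc n])) R Q
    = (\<Sum>S\<in>Pow ({0..<n} \<times> A). path_weight X n Q (set_layer n R S))"
proof (induction n arbitrary: R)
  case 0
  show ?case using assms by (simp add: op_mult_one_right path_weight_def)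
next
  case (Suc n)
  have "op_list_prod A (map X (rev [0..<Suc (Suc n)])) R Q
      = (\<Sum>R'\<in>Pow A. X (Suc n) R R' * op_list_prod A (map X (rev [0..<Suc n])) R' Q)"
    by (simp add: op_mult_def[of _ "X (Suc n)"])
  also have "\<dots> = (\<Sum>R'\<in>Pow A. \<Sum>S\<in>Pow ({0..<n} \<times> A).
      path_weight X (Suc n) Q (set_layer (Suc n) R (set_layer n R' S)))"
    unfolding Suc.IH path_weight_Suc by (simp add: sum_distrib_left)
  also have "\<dots> = (\<Sum>S\<in>Pow ({0..<Suc n} \<times> A). path_weight X (Suc n) Q (set_layer (Suc n) R S))"
    by (rule sum_Pow_Suc_layers[symmetric])
  finally show ?case .
qed

lemma trace_ordered_place:
  fixes N :: nat
  assumes "finite A" "N > 0" "is_op A (X 0)"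
  defines "M \<equiv> {0..<N} \<times> A"
  shows "op_trace M (parity_op M \<odot>\<^bsub>M\<^esub> time_shift N A
      \<odot>\<^bsub>M\<^esub> op_list_prod M (map (\<lambda>t. place {0..<N} A t (X t)) (rev [0..<N])))
    = op_trace A (op_list_prod A (map X (rev [0..<N])))"
proof -
  obtain n where N: "N = Suc n" using assms(2) by (cases N) auto
  have "op_trace A (op_list_prod A (map X (rev [0..<Suc n])))
      = (\<Sum>R\<in>Pow A. \<Sum>S\<in>Pow ({0..<n} \<times> A). path_weight X n (layer n (set_layer n R S)) (set_layer n R S))"
    unfolding op_trace_def ordered_prod_eq_sum_paths[where X = X, OF assms(1,3)] by simp
  also have "\<dots> = (\<Sum>S\<in>Pow ({0..<Suc n} \<times> A). path_weight X n (layer n S) S)"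
    by (rule sum_Pow_Suc_layers[symmetric])
  finally show ?thesis
    unfolding M_def N trace_ordered_place_eq_sum_paths[OF assms(1)] ..
qed

section \<open>Even and odd parts\<close>

definition parity_part :: "bool \<Rightarrow> 'm op \<Rightarrow> 'm op" where
  "parity_part p X = (\<lambda>S T. if odd (card S + card T) = p then X S T else 0)"

lemma is_op_parity_part [simp]: "is_op M X \<Longrightarrow> is_op M (parity_part p X)"
  by (simp add: is_op_def parity_part_def)

lemma has_parity_parity_part: "has_parity p (parity_part p X)"
  by (simp add: has_parity_def parity_part_def)

lemma add_parity_parts: "parity_part False X \<oplus> parity_part True X = X"
  by (auto simp: fun_eq_iff op_add_def parity_part_def)

lemma commute_parity_op_iff_has_parity:
  assumes "finite M" "is_op M X"
  shows "X \<odot>\<^bsub>M\<^esub> parity_op M = (if p then -1 else 1) \<cdot> (parity_op M \<odot>\<^bsub>M\<^esub> X) \<longleftrightarrow> has_parity p X"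
proof -
  have "(-1) ^ card T * X S T = (if p then -1 else 1) * ((-1) ^ card S * X S T)
      \<longleftrightarrow> (X S T \<noteq> 0 \<longrightarrow> odd (card S + card T) = p)" for S T
    by (cases p) (auto simp: minus_one_power_iff)
  then show ?thesis
    by (simp add: fun_eq_iff parity_op_eq_diag[OF assms(1)] op_mult_diag_right[OF assms]
        op_mult_diag_left[OF assms] op_scale_def has_parity_def)
qed

lemma is_even_op_iff: "is_op (modes_h L) X \<Longrightarrow> is_even_op L X \<longleftrightarrow> has_parity False X"
  using commute_parity_op_iff_has_parity[of "modes_h L" X False] by (simp add: is_even_op_def)

lemma is_odd_op_iff: "is_op (modes_h L) X \<Longrightarrow> is_odd_op L X \<longleftrightarrow> has_parity True X"
  using commute_parity_op_iff_has_parity[of "modes_h L" X True] by (simp add: is_odd_op_def)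

lemma op_diff_parity_part_False: "op_diff X (parity_part False X) = parity_part True X"
  by (auto simp: fun_eq_iff op_diff_def parity_part_def)

lemma even_part_unique:
  assumes "has_parity False E" "has_parity True (op_diff X E)"
  shows "E = parity_part False X"
proof (intro ext)
  fix S T
  show "E S T = parity_part False X S T"
    using assms[unfolded has_parity_def op_diff_def, THEN spec, THEN spec, of S T]
    by (cases "odd (card S + card T)") (auto simp: parity_part_def simp del: even_add odd_add)
qed

lemma even_part_eq:
  assumes "is_op (modes_h L) X"
  shows "even_part L X = parity_part False X"
  unfolding even_part_def
proof (rule the_equality)
  show "is_op (modes_h L) (parity_part False X) \<and> is_even_op L (parity_part False X)
      \<and> is_odd_op L (op_diff X (parity_part False X))"
    using assms
    by (simp add: is_even_op_iff is_odd_op_iff op_diff_parity_part_False has_parity_parity_part)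
next
  fix E assume "is_op (modes_h L) E \<and> is_even_op L E \<and> is_odd_op L (op_diff X E)"
  with assms show "E = parity_part False X"
    by (intro even_part_unique) (auto simp: is_even_op_iff is_odd_op_iff)
qed

lemma odd_part_eq: "is_op (modes_h L) X \<Longrightarrow> odd_part L X = parity_part True X"
  by (simp add: odd_part_def even_part_eq op_diff_parity_part_False)

lemma op_sum_Pow_insert:
  assumes "finite I" "x \<notin> I"
  shows "op_sum f (Pow (insert x I)) = op_sum f (Pow I) \<oplus> op_sum (\<lambda>B. f (insert x B)) (Pow I)"
proof -
  have "Pow I \<inter> insert x ` Pow I = {}" "inj_on (insert x) (Pow I)"
    using assms(2) by (auto simp: inj_on_def)
  then show ?thesis
    using assms(1) by (simp add: op_sum_def op_add_def Pow_insert sum.union_disjoint sum.reindex)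
qed

lemma op_list_prod_add_expand:
  assumes "distinct xs"
  shows "op_list_prod M (map (\<lambda>x. f False x \<oplus> f True x) xs)
    = op_sum (\<lambda>B. op_list_prod M (map (\<lambda>x. f (x \<in> B) x) xs)) (Pow (set xs))"
  using assms
proof (induction xs)
  case Nil
  show ?case by (simp add: op_sum_def)
next
  case (Cons x xs)
  let ?P = "\<lambda>B. op_list_prod M (map (\<lambda>x. f (x \<in> B) x) xs)"
  have "y \<in> insert x B \<longleftrightarrow> y \<in> B" if "y \<in> set xs" for y B
    using Cons.prems that by auto
  then have "?P (insert x B) = ?P B" for B
    by (simp cong: map_cong)
  moreover have "x \<notin> B" if "B \<in> Pow (set xs)" for B
    using that Cons.prems by auto
  then have "op_sum (\<lambda>B. f (x \<in> B) x \<odot>\<^bsub>M\<^esub> ?P B) (Pow (set xs))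
      = op_sum (\<lambda>B. f False x \<odot>\<^bsub>M\<^esub> ?P B) (Pow (set xs))"
    by (intro op_sum_cong) simp
  ultimately show ?case
    using Cons by (simp add: op_sum_Pow_insert op_mult_linear op_sum_add)
qed

section \<open>Time ordering\<close>

definition inversions :: "'l::linorder set \<Rightarrow> 'l list \<Rightarrow> nat" where
  "inversions B xs = card {(p, q). p < q \<and> q < length xs \<and> xs ! p \<in> B \<and> xs ! q \<in> B \<and> xs ! q < xs ! p}"

lemma inversions_Nil [simp]: "inversions B [] = 0"
  by (simp add: inversions_def)

lemma inversions_Cons:
  "inversions B (x # xs)
    = (if x \<in> B then length (filter (\<lambda>y. y \<in> B \<and> y < x) xs) else 0) + inversions B xs"
proof -
  define I where
    "I xs = {(p, q). p < q \<and> q < length xs \<and> xs ! p \<in> B \<and> xs ! q \<in> B \<and> xs ! q < xs ! p}" for xs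
  let ?J = "{q. q < length xs \<and> x \<in> B \<and> xs ! q \<in> B \<and> xs ! q < x}"
  have "I (x # xs) = Pair 0 ` Suc ` ?J \<union> map_prod Suc Suc ` I xs"
  proof (intro set_eqI)
    fix r :: "nat \<times> nat"
    show "r \<in> I (x # xs) \<longleftrightarrow> r \<in> Pair 0 ` Suc ` ?J \<union> map_prod Suc Suc ` I xs"
      by (cases r; cases "fst r"; cases "snd r") (auto simp: I_def image_iff)
  qed
  moreover have "finite (I xs)"
    by (rule finite_subset[of _ "{..<length xs} \<times> {..<length xs}"]) (auto simp: I_def)
  moreover have "Pair 0 ` Suc ` ?J \<inter> map_prod Suc Suc ` I xs = {}" by auto
  moreover have "inj_on (map_prod Suc Suc) (I xs)"
    by (auto simp: inj_on_def)
  ultimately have "card (I (x # xs)) = card ?J + card (I xs)"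
    by (simp add: card_Un_disjoint card_image inj_on_def)
  then show ?thesis
    by (simp add: inversions_def I_def length_filter_conv_card)
qed

lemma op_list_prod_insort:
  assumes "\<And>y. y \<in> set ys \<Longrightarrow> y < x \<Longrightarrow>
      Z x \<odot>\<^bsub>M\<^esub> Z y = (if x \<in> B \<and> y \<in> B then -1 else 1) \<cdot> (Z y \<odot>\<^bsub>M\<^esub> Z x)"
    and "sorted ys"
  shows "Z x \<odot>\<^bsub>M\<^esub> op_list_prod M (map Z ys)
    = (-1) ^ (if x \<in> B then length (filter (\<lambda>y. y \<in> B \<and> y < x) ys) else 0)
        \<cdot> op_list_prod M (map Z (insort x ys))"
  using assms
proof (induction ys)
  case Nil
  show ?case by simp
next
  case (Cons y ys)
  show ?case
  proof (cases "x \<le> y")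
    case True
    then have "filter (\<lambda>y. y \<in> B \<and> y < x) (y # ys) = []"
      using Cons.prems(2) by (auto simp: filter_empty_conv)
    then show ?thesis using True by (simp only: insort_key.simps) simp
  next
    case False
    let ?c = "if x \<in> B \<and> y \<in> B then -1 else 1 :: complex"
    let ?n = "if x \<in> B then length (filter (\<lambda>y. y \<in> B \<and> y < x) ys) else 0"
    have "Z x \<odot>\<^bsub>M\<^esub> op_list_prod M (map Z (y # ys)) = (Z x \<odot>\<^bsub>M\<^esub> Z y) \<odot>\<^bsub>M\<^esub> op_list_prod M (map Z ys)"
      by (simp add: op_mult_assoc)
    also have "\<dots> = ?c \<cdot> (Z y \<odot>\<^bsub>M\<^esub> Z x \<odot>\<^bsub>M\<^esub> op_list_prod M (map Z ys))"
      using Cons.prems(1)[of y] False by (simp add: op_mult_scale_left op_mult_assoc)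
    also have "Z x \<odot>\<^bsub>M\<^esub> op_list_prod M (map Z ys) = (-1) ^ ?n \<cdot> op_list_prod M (map Z (insort x ys))"
      using Cons.prems by (intro Cons.IH) auto
    finally show ?thesis
      using False by (simp add: op_mult_scale_right op_scale_scale not_le)
  qed
qed

lemma op_list_prod_sort:
  assumes "sorted_wrt (\<lambda>x y. y < x \<longrightarrow>
      Z x \<odot>\<^bsub>M\<^esub> Z y = (if x \<in> B \<and> y \<in> B then -1 else 1) \<cdot> (Z y \<odot>\<^bsub>M\<^esub> Z x)) xs"
  shows "op_list_prod M (map Z xs) = (-1) ^ inversions B xs \<cdot> op_list_prod M (map Z (sort xs))"
  using assms
proof (induction xs)
  case Nil
  show ?case by simp
next
  case (Cons x xs)
  have "length (filter P (sort xs)) = length (filter P xs)" for P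
    by (simp add: filter_sort)
  moreover have "Z x \<odot>\<^bsub>M\<^esub> op_list_prod M (map Z (sort xs))
      = (-1) ^ (if x \<in> B then length (filter (\<lambda>y. y \<in> B \<and> y < x) (sort xs)) else 0)
          \<cdot> op_list_prod M (map Z (insort x (sort xs)))"
    using Cons.prems by (intro op_list_prod_insort) auto
  ultimately show ?case
    using Cons by (simp add: inversions_Cons op_mult_scale_right op_scale_scale power_add mult.commute)
qed

lemma filter_less_Suc_of_decreasing:
  fixes \<tau> :: "'l \<Rightarrow> nat"
  assumes "sorted_wrt (\<lambda>x y. \<tau> y \<le> \<tau> x) xs"
  shows "filter (\<lambda>x. \<tau> x < Suc n) xs = filter (\<lambda>x. \<tau> x = n) xs @ filter (\<lambda>x. \<tau> x < n) xs"
  using assms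
proof (induction xs)
  case (Cons x xs)
  have "filter (\<lambda>x. \<tau> x = n) xs = []" if "\<tau> x < n"
    using Cons.prems that by (force simp: filter_empty_conv)
  with Cons show ?case by (auto simp: less_Suc_eq)
qed simp

lemma concat_filter_of_decreasing:
  fixes \<tau> :: "'l \<Rightarrow> nat"
  assumes "sorted_wrt (\<lambda>x y. \<tau> y \<le> \<tau> x) xs"
  shows "concat (map (\<lambda>t. filter (\<lambda>x. \<tau> x = t) xs) (rev [0..<n])) = filter (\<lambda>x. \<tau> x < n) xs"
  by (induction n) (simp_all add: filter_less_Suc_of_decreasing[OF assms])

lemma op_list_prod_concat:
  assumes "finite M" "\<forall>Xs\<in>set Xss. \<forall>X\<in>set Xs. is_op M X"
  shows "op_list_prod M (concat Xss) = op_list_prod M (map (op_list_prod M) Xss)"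
  using assms(2) by (induction Xss) (simp_all add: op_list_prod_append[OF assms(1)])

lemma op_list_prod_group_decreasing:
  fixes \<tau> :: "'l \<Rightarrow> nat"
  assumes "finite M" "\<forall>x\<in>set xs. is_op M (f x)"
    and "sorted_wrt (\<lambda>x y. \<tau> y \<le> \<tau> x) xs" "\<forall>x\<in>set xs. \<tau> x < n"
  shows "op_list_prod M (map f xs)
    = op_list_prod M (map (\<lambda>t. op_list_prod M (map f (filter (\<lambda>x. \<tau> x = t) xs))) (rev [0..<n]))"
proof -
  have "map f xs = map f (concat (map (\<lambda>t. filter (\<lambda>x. \<tau> x = t) xs) (rev [0..<n])))"
    using concat_filter_of_decreasing[OF assms(3), of n] assms(4) by simp
  also have "\<dots> = concat (map (\<lambda>t. map f (filter (\<lambda>x. \<tau> x = t) xs)) (rev [0..<n]))"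
    by (simp add: map_concat comp_def)
  finally have "map f xs = concat (map (\<lambda>t. map f (filter (\<lambda>x. \<tau> x = t) xs)) (rev [0..<n]))" .
  then show ?thesis
    using assms(2) by (simp add: op_list_prod_concat[OF assms(1)] comp_def)
qed

lemma place_list_prod:
  assumes "finite I" "finite A" "t \<in> I"
  shows "place I A t (op_list_prod A Xs) = op_list_prod (I \<times> A) (map (place I A t) Xs)"
  by (induction Xs) (simp_all add: place_one place_mult[OF assms])

lemma op_list_prod_place_group_decreasing:
  fixes \<tau> :: "'l \<Rightarrow> nat"
  assumes "finite A" "sorted_wrt (\<lambda>x y. \<tau> y \<le> \<tau> x) xs" "\<forall>x\<in>set xs. \<tau> x < N"
  shows "op_list_prod ({0..<N} \<times> A) (map (\<lambda>x. place {0..<N} A (\<tau> x) (Y x)) xs)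
    = op_list_prod ({0..<N} \<times> A)
        (map (\<lambda>t. place {0..<N} A t (op_list_prod A (map Y (filter (\<lambda>x. \<tau> x = t) xs)))) (rev [0..<N]))"
proof -
  let ?M = "{0..<N} \<times> A" and ?Z = "\<lambda>x. place {0..<N} A (\<tau> x) (Y x)"
  have same_slice: "op_list_prod ?M (map ?Z (filter (\<lambda>x. \<tau> x = t) xs))
      = place {0..<N} A t (op_list_prod A (map Y (filter (\<lambda>x. \<tau> x = t) xs)))" if "t < N" for t
    using that assms(1)
    by (subst place_list_prod) (auto simp: comp_def intro!: arg_cong[where f = "op_list_prod _"])
  have "op_list_prod ?M (map ?Z xs)
      = op_list_prod ?M (map (\<lambda>t. op_list_prod ?M (map ?Z (filter (\<lambda>x. \<tau> x = t) xs))) (rev [0..<N]))"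
    using assms by (intro op_list_prod_group_decreasing) simp_all
  also have "\<dots> = op_list_prod ?M
      (map (\<lambda>t. place {0..<N} A t (op_list_prod A (map Y (filter (\<lambda>x. \<tau> x = t) xs)))) (rev [0..<N]))"
    by (intro arg_cong[where f = "op_list_prod ?M"] map_cong refl same_slice) simp
  finally show ?thesis .
qed

lemma trace_place_decreasing:
  fixes N :: nat and \<tau> :: "'l \<Rightarrow> nat"
  assumes "finite A" "N > 0" and "\<forall>x\<in>set xs. is_op A (Y x)"
    and "sorted_wrt (\<lambda>x y. \<tau> y \<le> \<tau> x) xs" "\<forall>x\<in>set xs. \<tau> x < N"
  defines "M \<equiv> {0..<N} \<times> A"
  shows "op_trace M (parity_op M \<odot>\<^bsub>M\<^esub> time_shift N A
      \<odot>\<^bsub>M\<^esub> op_list_prod M (map (\<lambda>x. place {0..<N} A (\<tau> x) (Y x)) xs))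
    = op_trace A (op_list_prod A (map Y xs))"
proof -
  let ?X = "\<lambda>t. op_list_prod A (map Y (filter (\<lambda>x. \<tau> x = t) xs))"
  have "op_list_prod A (map Y xs) = op_list_prod A (map ?X (rev [0..<N]))"
    using assms by (intro op_list_prod_group_decreasing) simp_all
  then show ?thesis
    unfolding M_def op_list_prod_place_group_decreasing[OF assms(1,4,5)]
    using assms trace_ordered_place[of A N ?X] by simp
qed

lemma trace_place_homogeneous:
  fixes N :: nat and \<tau> :: "'l::linorder \<Rightarrow> nat"
  assumes A: "finite A" and "N > 0" and \<tau>: "\<forall>l\<in>set xs. \<tau> l < N"
    and Y: "\<forall>l\<in>set xs. is_op A (Y l)" "\<forall>l\<in>set xs. has_parity (l \<in> B) (Y l)"
    and sorted: "sorted_wrt (\<lambda>p q. \<tau> q \<le> \<tau> p \<and> (\<tau> p = \<tau> q \<longrightarrow> p < q)) xs"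
  defines "M \<equiv> {0..<N} \<times> A"
  shows "op_trace M (parity_op M \<odot>\<^bsub>M\<^esub> time_shift N A
      \<odot>\<^bsub>M\<^esub> op_list_prod M (map (\<lambda>l. place {0..<N} A (\<tau> l) (Y l)) (sort xs)))
    = (-1) ^ inversions B xs * op_trace A (op_list_prod A (map Y xs))"
proof -
  let ?Z = "\<lambda>l. place {0..<N} A (\<tau> l) (Y l)"
  have decreasing: "sorted_wrt (\<lambda>p q. \<tau> q \<le> \<tau> p) xs"
    using sorted by (rule sorted_wrt_mono_rel[rotated]) auto
  have commute: "?Z p \<odot>\<^bsub>M\<^esub> ?Z q = (if p \<in> B \<and> q \<in> B then -1 else 1) \<cdot> (?Z q \<odot>\<^bsub>M\<^esub> ?Z p)"
    if "p \<in> set xs" "q \<in> set xs" "\<tau> p \<noteq> \<tau> q" for p q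
    unfolding M_def using A \<tau> Y(2) that by (intro place_commute) simp_all
  have "sorted_wrt (\<lambda>p q. q < p \<longrightarrow>
      ?Z p \<odot>\<^bsub>M\<^esub> ?Z q = (if p \<in> B \<and> q \<in> B then -1 else 1) \<cdot> (?Z q \<odot>\<^bsub>M\<^esub> ?Z p)) xs"
    by (intro sorted_wrt_mono_rel[OF _ sorted] impI commute) auto
  then have "op_list_prod M (map ?Z xs) = (-1) ^ inversions B xs \<cdot> op_list_prod M (map ?Z (sort xs))"
    by (rule op_list_prod_sort)
  then have "op_list_prod M (map ?Z (sort xs)) = (-1) ^ inversions B xs \<cdot> op_list_prod M (map ?Z xs)"
    by (simp add: op_scale_scale flip: power_mult_distrib)
  then show ?thesis
    using trace_place_decreasing[OF A \<open>N > 0\<close> Y(1) decreasing \<tau>]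
    by (simp add: M_def op_mult_linear op_trace_scale)
qed

lemma permutation_sorting_unique:
  fixes key :: "nat \<Rightarrow> 'b::linorder"
  assumes "inj key" "\<sigma> permutes {0..<k}" "\<sigma>' permutes {0..<k}"
    and "sorted_wrt (<) (map (\<lambda>p. key (\<sigma> p)) [0..<k])" "sorted_wrt (<) (map (\<lambda>p. key (\<sigma>' p)) [0..<k])"
  shows "\<sigma> = \<sigma>'"
proof
  fix p
  have "set (map (\<lambda>p. key (\<rho> p)) [0..<k]) = key ` {0..<k}" if "\<rho> permutes {0..<k}" for \<rho>
    using permutes_image[OF that] by (metis image_image set_map set_upt)
  then have "map (\<lambda>p. key (\<sigma> p)) [0..<k] = map (\<lambda>p. key (\<sigma>' p)) [0..<k]"
    using assms(2-5) by (intro strict_sorted_equal) simp_all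
  then show "\<sigma> p = \<sigma>' p"
    using assms(1) permutes_not_in[OF assms(2), of p] permutes_not_in[OF assms(3), of p]
    by (cases "p < k") (auto simp: inj_eq)
qed

lemma permutation_sorting_exists:
  fixes key :: "nat \<Rightarrow> 'b::linorder"
  assumes "inj key"
  obtains \<sigma> where "\<sigma> permutes {0..<k}" "sorted_wrt (<) (map (\<lambda>p. key (\<sigma> p)) [0..<k])"
proof -
  have "mset (sort_key key [0..<k]) = mset [0..<k]" by simp
  then obtain \<sigma> where \<sigma>: "\<sigma> permutes {..<length [0..<k]}" "permute_list \<sigma> [0..<k] = sort_key key [0..<k]"
    by (rule mset_eq_permutation)
  have "map \<sigma> [0..<k] = permute_list \<sigma> [0..<k]"
    using permutes_in_image[OF \<sigma>(1)] by (auto simp: permute_list_def)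
  then have "map (\<lambda>p. key (\<sigma> p)) [0..<k] = map key (sort_key key [0..<k])"
    by (simp flip: \<sigma>(2) map_map[unfolded comp_def])
  then have "sorted_wrt (<) (map (\<lambda>p. key (\<sigma> p)) [0..<k])"
    using assms by (simp add: strict_sorted_iff distinct_map inj_on_subset[OF assms])
  with \<sigma>(1) that show thesis by (simp add: lessThan_atLeast0)
qed

lemma sort_perm_sorts:
  shows "sort_perm k s permutes {0..<k}"
    and "sorted_wrt (\<lambda>l m. s m \<le> s l \<and> (s l = s m \<longrightarrow> l < m)) (map (sort_perm k s) [0..<k])"
proof -
  define key where "key l = (- s l, l)" for l
  have inj: "inj key" by (auto simp: inj_def key_def)
  have key_less: "key l < key m \<longleftrightarrow> s m \<le> s l \<and> (s l = s m \<longrightarrow> l < m)" for l m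
    by (auto simp: key_def less_prod_def)
  let ?P = "\<lambda>\<sigma>. \<sigma> permutes {0..<k} \<and> (\<forall>p q. p < q \<and> q < k \<longrightarrow> s (\<sigma> q) \<le> s (\<sigma> p)) \<and>
       (\<forall>p q. p < q \<and> q < k \<and> s (\<sigma> p) = s (\<sigma> q) \<longrightarrow> \<sigma> p < \<sigma> q)"
  have "sorted_wrt (<) (map (\<lambda>p. key (\<sigma> p)) [0..<k])
      \<longleftrightarrow> (\<forall>p q. p < q \<and> q < k \<longrightarrow> key (\<sigma> p) < key (\<sigma> q))" for \<sigma>
    by (auto simp: sorted_wrt_iff_nth_less)
  then have P_iff: "?P \<sigma> \<longleftrightarrow> \<sigma> permutes {0..<k} \<and> sorted_wrt (<) (map (\<lambda>p. key (\<sigma> p)) [0..<k])" for \<sigma>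
    by (simp add: key_less imp_conjR all_conj_distrib flip: imp_conjL)
  obtain \<sigma> where "\<sigma> permutes {0..<k}" "sorted_wrt (<) (map (\<lambda>p. key (\<sigma> p)) [0..<k])"
    by (rule permutation_sorting_exists[OF inj])
  then have "\<exists>!\<sigma>. ?P \<sigma>"
    unfolding P_iff by (intro ex1I[of _ \<sigma>] conjI permutation_sorting_unique[OF inj]) auto
  then have "?P (sort_perm k s)"
    unfolding sort_perm_def by (rule theI')
  then show "sort_perm k s permutes {0..<k}"
    and "sorted_wrt (\<lambda>l m. s m \<le> s l \<and> (s l = s m \<longrightarrow> l < m)) (map (sort_perm k s) [0..<k])"
    unfolding P_iff by (simp_all add: sorted_wrt_map key_less)
qed

lemma sort_map_sort_perm: "sort (map (sort_perm k s) [0..<k]) = [0..<k]"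
proof -
  have "set (map (sort_perm k s) [0..<k]) = {0..<k}" "distinct (map (sort_perm k s) [0..<k])"
    using permutes_image[OF sort_perm_sorts(1)] permutes_inj_on[OF sort_perm_sorts(1)]
    by (simp_all add: distinct_map)
  then show ?thesis
    by (intro sorted_distinct_set_unique) simp_all
qed

lemma time_order_eq_sum:
  fixes s :: "nat \<Rightarrow> real"
  assumes "\<And>l. l < k \<Longrightarrow> is_op (modes_h L) (X l)"
  defines "xs \<equiv> map (sort_perm k s) [0..<k]"
  shows "time_order L k X s = op_sum (\<lambda>B. (-1) ^ inversions B xs
    \<cdot> op_list_prod (modes_h L) (map (\<lambda>l. parity_part (l \<in> B) (X l)) xs)) (Pow {0..<k})"
proof -
  let ?\<sigma> = "sort_perm k s"
  have "?\<sigma> p < k" if "p < k" for p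
    using permutes_in_image[OF sort_perm_sorts(1)[of k s], of p] that by simp
  then have "map (\<lambda>p. if ?\<sigma> p \<in> B then odd_part L (X (?\<sigma> p)) else even_part L (X (?\<sigma> p))) [0..<k]
      = map (\<lambda>l. parity_part (l \<in> B) (X l)) xs" for B
    using assms(1) by (auto simp: xs_def odd_part_eq even_part_eq)
  moreover have "{(p, q). p < q \<and> q < k \<and> ?\<sigma> p \<in> B \<and> ?\<sigma> q \<in> B \<and> ?\<sigma> q < ?\<sigma> p}
      = {(p, q). p < q \<and> q < length xs \<and> xs ! p \<in> B \<and> xs ! q \<in> B \<and> xs ! q < xs ! p}" for B
    by (auto simp: xs_def)
  ultimately show ?thesis
    unfolding time_order_def Let_def inversions_def by (simp only:)
qed

lemma prod_slices_expand:
  assumes "length ts = length Xs" "\<forall>X\<in>set Xs. is_op (modes_h L) X" "\<forall>t\<in>set ts. t < N"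
  shows "op_list_prod M (map2 (\<lambda>X t. slice N L t X) Xs ts) = op_sum (\<lambda>B. op_list_prod M
    (map (\<lambda>l. place {0..<N} (modes_h L) (ts ! l) (parity_part (l \<in> B) (Xs ! l))) [0..<length Xs]))
    (Pow {0..<length Xs})"
proof -
  let ?f = "\<lambda>p l. place {0..<N} (modes_h L) (ts ! l) (parity_part p (Xs ! l))"
  have "map2 (\<lambda>X t. slice N L t X) Xs ts = map (\<lambda>l. ?f False l \<oplus> ?f True l) [0..<length Xs]"
    using assms by (intro nth_equalityI) (simp_all add: slice_eq_place add_parity_parts flip: place_add)
  then show ?thesis
    using op_list_prod_add_expand[of "[0..<length Xs]" M ?f] by simp
qed

theorem theorem2:
  fixes L N :: nat and \<epsilon> :: real and Os :: "nat op list" and ts :: "nat list"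
  assumes "L \<ge> 1" and "N \<ge> 1" and "\<epsilon> > 0"
    and "length ts = length Os"
    and "\<forall>X\<in>set Os. is_op (modes_h L) X"
    and "\<forall>t\<in>set ts. t < N"
  shows "op_trace (modes_H N L)
           (op_mult (modes_H N L) (parity_op (modes_H N L))
             (op_mult (modes_H N L) (op_exp (modes_H N L) (op_scale (\<i> * of_real \<epsilon>) (calP \<epsilon> N L)))
               (op_list_prod (modes_H N L) (map2 (\<lambda>X t. slice N L t X) Os ts))))
       = op_trace (modes_h L)
           (time_order L (length Os) (\<lambda>l. Os ! l) (\<lambda>l. real (ts ! l)))"
proof -
  let ?A = "modes_h L" and ?M = "modes_H N L" and ?k = "length Os"
  define xs where "xs = map (sort_perm ?k (\<lambda>l. real (ts ! l))) [0..<?k]"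
  let ?Y = "\<lambda>B l. parity_part (l \<in> B) (Os ! l)"
  have set_xs: "set xs = {0..<?k}" and sort_xs: "sort xs = [0..<?k]"
    by (simp_all only: xs_def sort_map_sort_perm set_map set_upt permutes_image[OF sort_perm_sorts(1)])
  have "op_trace ?M (parity_op ?M \<odot>\<^bsub>?M\<^esub> time_shift N ?A
        \<odot>\<^bsub>?M\<^esub> op_list_prod ?M (map (\<lambda>l. place {0..<N} ?A (ts ! l) (?Y B l)) (sort xs)))
      = (-1) ^ inversions B xs * op_trace ?A (op_list_prod ?A (map (?Y B) xs))" for B
    unfolding modes_H_eq
  proof (rule trace_place_homogeneous)
    show "sorted_wrt (\<lambda>l m. ts ! m \<le> ts ! l \<and> (ts ! l = ts ! m \<longrightarrow> l < m)) xs"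
      using sort_perm_sorts(2)[of "\<lambda>l. real (ts ! l)" ?k] by (simp add: xs_def)
  qed (use assms set_xs in \<open>auto simp: has_parity_parity_part\<close>)
  then show ?thesis
    unfolding op_exp_calP[OF assms(3)] prod_slices_expand[OF assms(4-6)] sort_xs
    using assms(5) by (subst time_order_eq_sum)
      (simp_all add: xs_def op_mult_linear op_trace_sum op_trace_scale)
qed

end
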